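(* Let $p\ge1$ be an integer, and for a random variable $X$ with density let $\tilde H_s(X_{fp})=p-\frac12-\mathbb{E}[\log(|X|f_X(X))]$ be its approximate floating-point entropy; for a random vector let $\tilde H_s(\mathbf{X}_{fp})$ be as defined in the context. Then the following closed forms hold. 1. $X\sim\mathcal{N}(0,\sigma^2)$, $\sigma>0$: $\tilde H_s(X_{fp})=p+\frac12\log(2\pi e)+\frac{\gamma_e}{2\ln2}$. 2. $X\sim\mathrm{Uniform}(-a,a)$, $a>0$: $\tilde H_s(X_{fp})=p+\frac12+\log e$. 3. $X\sim\mathrm{Gamma}(\alpha,\theta)$ (shape $\alpha>0$, scale $\theta>0$): $\tilde H_s(X_{fp})=p-\frac12+\alpha\log(e)(1-\psi(\alpha))+\log\Gamma(\alpha)$. 4. $X\sim\chi^2(k)$, $k>0$: $\tilde H_s(X_{fp})=p-\frac12+\frac k2\log(e)\left(1-\psi\left(\frac k2\right)\right)+\log\Gamma\left(\frac k2\right)$. 5. $X\sim\mathrm{Laplace}(0,b)$, $b>0$: $\tilde H_s(X_{fp})=p+\frac12+\frac{1+\gamma_e}{\ln2}$. 6. $X\sim\mathrm{Logistic}(0,s)$, $s>0$: $\tilde H_s(X_{fp})=p-\frac12+\frac{2+\gamma_e-\ln(\pi/2)}{\ln2}$. 7. $X\sim\mathrm{Weibull}(\lambda,k)$ (scale $\lambda>0$, shape $k>0$): $\tilde H_s(X_{fp})=p-\frac12+\frac{1+\gamma_e}{\ln2}-\log k$. 8. $X\sim\mathrm{Lognormal}(\mu,\sigma^2)$, $\mu\in\mathbb{R}$,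 $\sigma>0$: $\tilde H_s(X_{fp})=p-\frac12+\log(\sigma\sqrt{2\pi e})$. 9. $X\sim\mathrm{Pareto}(x_m,\alpha)$ (scale $x_m>0$, shape $\alpha>0$): $\tilde H_s(X_{fp})=p-\frac12+\log\left(\frac e\alpha\right)$. 10. $X\sim\mathrm{Beta}(\alpha,\beta)$, $\alpha,\beta>0$: $\tilde H_s(X_{fp})=p-\frac12+\log B(\alpha,\beta)+\frac{(\alpha+\beta-1)\psi(\alpha+\beta)-\alpha\psi(\alpha)-(\beta-1)\psi(\beta)}{\ln2}$. 11. $X\sim t_\nu(0,s)$ (centered Student's $t$ with $\nu>0$ degrees of freedom and scale $s>0$): $\tilde H_s(X_{fp})=p-\frac12+\log B\left(\frac\nu2,\frac12\right)+\frac{\frac{\nu+1}{2}\psi\left(\frac{\nu+1}{2}\right)-\frac\nu2\psi\left(\frac\nu2\right)-\frac12\psi\left(\frac12\right)}{\ln2}$. 12. $\mathbf{X}\sim\mathcal{N}(\mathbf{0}_d,\Sigma)$ with $d\ge1$ and $\Sigma$ a $d\times d$ positive definite covariance matrix with eigenvalues $\lambda_1(\Sigma),\dots,\lambda_d(\Sigma)$: $\tilde H_s(\mathbf{X}_{fp})=d\left(p+\frac12\log(2\pi e)+\frac{\gamma_e}{2\ln2}\right)+\frac12\log\left(\frac{\prod_{i=1}^d\lambda_i(\Sigma)}{\prod_{i=1}^d\Sigma_{ii}}\right)$.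
   Context: $\log$ is base 2 and $\ln$ is the natural logarithm. $\gamma_e$ is the Euler-Mascheroni constant, $\Gamma$ the gamma function, $\psi$ the digamma function, $B(\cdot,\cdot)$ the beta function. The differential entropy is $h(\mathbf{X})=-\int f_{\mathbf{X}}\log f_{\mathbf{X}}$. For a $d$-dimensional random vector $\mathbf{X}=(X_1,\dots,X_d)$ with density $f_{\mathbf{X}}$, whose components are independently quantized to floating-point numbers of precision $p$, the approximate floating-point entropy is the quantity $\tilde H_s(\mathbf{X}_{fp})=d(p-\frac12)+h(\mathbf{X})-\sum_{j=1}^d\mathbb{E}[\log|X_j|]$ (for $d=1$ this equals $p-\frac12-\mathbb{E}[\log(|X|f_X(X))]$). Conventions: $\mathrm{Lognormal}(\mu,\sigma^2)$ means $\ln X\sim\mathcal{N}(\mu,\sigma^2)$; Laplace$(0,b)$ has density $\frac1{2b}e^{-|x|/b}$; Logistic$(0,s)$ has density $\frac{e^{-x/s}}{s(1+e^{-x/s})^2}$; Weibull$(\lambda,k)$ has density $\frac k\lambda(x/\lambda)^{k-1}e^{-(x/\lambda)^k}$ on $x>0$; Pareto$(x_m,\alpha)$ has density $\alpha x_m^\alpha x^{-\alpha-1}$ on $x\ge x_m$; $t_\nu(0,s)$ is the law of $sT$ with $T$ standard Student's $t$ with $\nu$ degrees of freedom. *)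

theory Defs
  imports
    "HOL-Probability.Probability"
    "HOL-Computational_Algebra.Polynomial"
begin

section \<open>Approximate floating-point entropy\<close>

text \<open>
  The density of a random variable is determined by its law up to a Lebesgue null set.  The
  Radon-Nikodym derivative fixes one version, so that the entropies below depend on the
  random variable only.  It is a genuine density only if the law is absolutely continuous; this
  is part of \<open>fp_entropy_exists\<close> and \<open>fp_entropy_vec_exists\<close>.
\<close>

definition pdf :: "'a measure \<Rightarrow> ('a \<Rightarrow> 'b::euclidean_space) \<Rightarrow> 'b \<Rightarrow> real" where
  "pdf M X x = enn2real (RN_deriv lborel (distr M lborel X) x)"

definition fp_entropy :: "nat \<Rightarrow> 'a measure \<Rightarrow> ('a \<Rightarrow> real) \<Rightarrow> real" where
  "fp_entropy p M X = real p - 1/2 - (\<integral>\<omega>. log 2 (\<bar>X \<omega>\<bar> * pdf M X (X \<omega>)) \<partial>M)"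

text \<open>
  The Bochner integral of a non-integrable function is 0, so the existence of the expectations has
  to be stated separately.
\<close>

definition fp_entropy_exists :: "'a measure \<Rightarrow> ('a \<Rightarrow> real) \<Rightarrow> bool" where
  "fp_entropy_exists M X \<longleftrightarrow>
     distributed M lborel X (\<lambda>x. ennreal (pdf M X x)) \<and>
     integrable M (\<lambda>\<omega>. log 2 (\<bar>X \<omega>\<bar> * pdf M X (X \<omega>)))"

text \<open>
  For a random vector with density \<open>f\<close>, the library's \<open>entropy 2 lborel X\<close> is the differential
  entropy \<open>- (\<integral>x. f x * log 2 (f x) \<partial>lborel)\<close>, see \<open>information_space.entropy_distr\<close>.
\<close>

definition fp_entropy_vec :: "nat \<Rightarrow> 'a measure \<Rightarrow> ('a \<Rightarrow> real ^ 'n) \<Rightarrow> real" where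
  "fp_entropy_vec p M X =
     real CARD('n) * (real p - 1/2) + prob_space.entropy M 2 lborel X
       - (\<Sum>j\<in>UNIV. \<integral>\<omega>. log 2 \<bar>X \<omega> $ j\<bar> \<partial>M)"

definition fp_entropy_vec_exists :: "'a measure \<Rightarrow> ('a \<Rightarrow> real ^ 'n) \<Rightarrow> bool" where
  "fp_entropy_vec_exists M X \<longleftrightarrow>
     distributed M lborel X (\<lambda>x. ennreal (pdf M X x)) \<and>
     integrable lborel (\<lambda>x. pdf M X x * log 2 (pdf M X x)) \<and>
     (\<forall>j. integrable M (\<lambda>\<omega>. log 2 \<bar>X \<omega> $ j\<bar>))"


section \<open>Probability distributions\<close>

definition uniform_density :: "real \<Rightarrow> real \<Rightarrow> real \<Rightarrow> real" where
  "uniform_density a b x = indicator {a..b} x / (b - a)"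

definition gamma_density :: "real \<Rightarrow> real \<Rightarrow> real \<Rightarrow> real" where
  "gamma_density \<alpha> \<theta> x =
     (if 0 < x then x powr (\<alpha> - 1) * exp (- x / \<theta>) / (Gamma \<alpha> * \<theta> powr \<alpha>) else 0)"

definition chi_square_density :: "real \<Rightarrow> real \<Rightarrow> real" where
  "chi_square_density k x =
     (if 0 < x then x powr (k / 2 - 1) * exp (- x / 2) / (2 powr (k / 2) * Gamma (k / 2)) else 0)"

definition laplace_density :: "real \<Rightarrow> real \<Rightarrow> real" where
  "laplace_density b x = 1 / (2 * b) * exp (- \<bar>x\<bar> / b)"

definition logistic_density :: "real \<Rightarrow> real \<Rightarrow> real" where
  "logistic_density s x = exp (- x / s) / (s * (1 + exp (- x / s))\<^sup>2)"

definition weibull_density :: "real \<Rightarrow> real \<Rightarrow> real \<Rightarrow> real" where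
  "weibull_density l k x =
     (if 0 < x then k / l * (x / l) powr (k - 1) * exp (- ((x / l) powr k)) else 0)"

definition pareto_density :: "real \<Rightarrow> real \<Rightarrow> real \<Rightarrow> real" where
  "pareto_density x\<^sub>m \<alpha> x = (if x\<^sub>m \<le> x then \<alpha> * x\<^sub>m powr \<alpha> * x powr (- \<alpha> - 1) else 0)"

definition beta_density :: "real \<Rightarrow> real \<Rightarrow> real \<Rightarrow> real" where
  "beta_density \<alpha> \<beta> x =
     (if 0 < x \<and> x < 1 then x powr (\<alpha> - 1) * (1 - x) powr (\<beta> - 1) / Beta \<alpha> \<beta> else 0)"

definition student_t_density :: "real \<Rightarrow> real \<Rightarrow> real" where
  "student_t_density \<nu> t =
     Gamma ((\<nu> + 1) / 2) / (sqrt (\<nu> * pi) * Gamma (\<nu> / 2)) * (1 + t\<^sup>2 / \<nu>) powr (- (\<nu> + 1) / 2)"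

definition student_t_distributed :: "'a measure \<Rightarrow> ('a \<Rightarrow> real) \<Rightarrow> real \<Rightarrow> real \<Rightarrow> bool" where
  "student_t_distributed M X \<nu> s \<longleftrightarrow>
     X \<in> borel_measurable M \<and>
     distr M borel X = distr (density lborel (\<lambda>t. ennreal (student_t_density \<nu> t))) borel (\<lambda>t. s * t)"

text \<open>
  Positivity of \<open>X\<close> has to be required, since \<open>ln\<close> is a total function in HOL.
\<close>

definition lognormal_distributed :: "'a measure \<Rightarrow> ('a \<Rightarrow> real) \<Rightarrow> real \<Rightarrow> real \<Rightarrow> bool" where
  "lognormal_distributed M X \<mu> \<sigma> \<longleftrightarrow>
     X \<in> borel_measurable M \<and> (AE \<omega> in M. 0 < X \<omega>) \<and>
     distributed M lborel (\<lambda>\<omega>. ln (X \<omega>)) (\<lambda>x. ennreal (normal_density \<mu> \<sigma> x))"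

text \<open>The density of the centered multivariate normal distribution with covariance matrix \<open>S\<close>.\<close>

definition mv_normal_density :: "real ^ 'n ^ 'n \<Rightarrow> real ^ 'n \<Rightarrow> real" where
  "mv_normal_density S x =
     exp (- (x \<bullet> (matrix_inv S *v x)) / 2) / sqrt ((2 * pi) ^ CARD('n) * det S)"


section \<open>Matrices\<close>

definition pos_def_matrix :: "real ^ 'n ^ 'n \<Rightarrow> bool" where
  "pos_def_matrix S \<longleftrightarrow> transpose S = S \<and> (\<forall>x. x \<noteq> 0 \<longrightarrow> 0 < x \<bullet> (S *v x))"

definition char_poly :: "real ^ 'n ^ 'n \<Rightarrow> real poly" where
  "char_poly S = det (\<chi> i j. (if i = j then [:0, 1:] else 0) - [:S $ i $ j:])"

text \<open>
  The real eigenvalues with their algebraic multiplicities.  A symmetric matrix of size \<open>n\<close> has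
  exactly \<open>n\<close> of them.
\<close>

definition eigenvalues :: "real ^ 'n ^ 'n \<Rightarrow> real multiset" where
  "eigenvalues S = proots (char_poly S)"

end

theory Submission
  imports Defs
begin

text \<open>
  Most of the entropies are derivatives at 0: if \<open>X\<close> has density \<open>f\<close>, then
  \<open>E[ln (\<bar>X\<bar> f(X))] = \<Phi>'(0)\<close> for \<open>\<Phi>(t) = \<integral> f(x) (\<bar>x\<bar> f(x))\<^sup>t dx\<close>, which for most families is again a
  Gamma or Beta integral. For the logistic law, \<open>E[ln \<bar>X\<bar>]\<close> comes from expanding \<open>y / (1 + y)\<^sup>2\<close> at
  \<open>y = exp (- x)\<close> and from Wallis' product. For the multivariate normal law, \<open>\<integral> f\<^bsup>1+t\<^esup>\<close> follows from
  \<open>\<integral> f = 1\<close> by scaling, the marginals follow from the translation invariance of Lebesgue measure, and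
  the product of the eigenvalues is the determinant by the spectral theorem.
\<close>


section \<open>Logarithmic moments\<close>

text \<open>Each closed form also asserts that its expectation exists, so values are carried as
  \<open>has_bochner_integral\<close>. Knowing \<open>\<Phi>\<close> on both sides of 0 pays twice:
  the moments of orders 2d and -2d dominate the difference quotients, which settles integrability
  and differentiation under the integral sign once for all families. The product |x| f(x) is
  invariant under rescaling of X, since |x| f(x/s)/s is |y| f(y) at y = x/s; hence no scale
  parameter survives in the one-dimensional forms. That X has density f forces the integral of f to
  be 1. This determines the constant of the generalized gamma families and supplies the Gaussian
  integral in any dimension without diagonalizing the quadratic form. The logistic law resists
  because |x|^t f(x)^(1+t) is not a Gamma or Beta integrand, whereas f(x)^(1+t) alone becomes one;
  so ln |x| and ln f are integrated separately.\<close>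

lemma abs_exp_diff_quotient_le:
  fixes L t d :: real
  assumes "0 < d" "0 < t" "t \<le> d"
  shows "\<bar>(exp (t * L) - 1) / t\<bar> \<le> (exp (2 * d * L) + exp (- 2 * d * L)) / d"
proof -
  have "\<bar>exp z - 1\<bar> \<le> \<bar>z\<bar> * exp \<bar>z\<bar>" for z :: real
  proof (cases "0 \<le> z")
    case True
    have "(1 - z) * exp z \<le> exp (- z) * exp z"
      using exp_ge_add_one_self[of "- z"] by (intro mult_right_mono) auto
    also have "\<dots> = 1"
      by (simp flip: exp_add)
    finally show ?thesis
      using True by (simp add: algebra_simps)
  next
    case False
    have "1 - exp z \<le> \<bar>z\<bar> * 1"
      using exp_ge_add_one_self[of z] by linarith
    also have "\<dots> \<le> \<bar>z\<bar> * exp \<bar>z\<bar>"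
      by (intro mult_left_mono) auto
    finally show ?thesis
      using False by simp
  qed
  from this[of "t * L"] have "\<bar>(exp (t * L) - 1) / t\<bar> \<le> \<bar>L\<bar> * exp (t * \<bar>L\<bar>)"
    using assms by (simp add: abs_mult field_simps)
  \<comment> \<open>The factor \<open>\<bar>L\<bar>\<close> is traded for a second exponential, and
    the sum over both signs then replaces the absolute value. With \<open>L = ln w\<close> the bound
    consists of the moments of orders 2d and -2d and no longer contains \<open>t\<close>.\<close>
  also have "\<dots> \<le> (exp (d * \<bar>L\<bar>) / d) * exp (d * \<bar>L\<bar>)"
  proof (intro mult_mono)
    have "d * \<bar>L\<bar> \<le> exp (d * \<bar>L\<bar>)"
      using exp_ge_add_one_self[of "d * \<bar>L\<bar>"] by linarith
    then show "\<bar>L\<bar> \<le> exp (d * \<bar>L\<bar>) / d"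
      using assms by (simp add: field_simps)
  qed (use assms in \<open>auto intro!: mult_right_mono\<close>)
  also have "\<dots> = exp (2 * d * \<bar>L\<bar>) / d"
    by (simp flip: exp_add)
  also have "\<dots> \<le> (exp (2 * d * L) + exp (- 2 * d * L)) / d"
    using assms by (intro divide_right_mono) (auto simp: abs_if)
  finally show ?thesis .
qed

text \<open>
  Points with \<open>w x = 0\<close> drop out on both sides, since \<open>0 powr t = 0\<close> (also for \<open>t = 0\<close>) and \<open>ln 0 = 0\<close>.
\<close>

lemma has_bochner_integral_ln_moment:
  fixes g w :: "'a \<Rightarrow> real"
  assumes [measurable]: "g \<in> borel_measurable N" "w \<in> borel_measurable N"
  assumes g: "\<And>x. 0 \<le> g x" and w: "\<And>x. 0 \<le> w x"
  assumes "0 < \<epsilon>"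
  assumes \<Phi>: "\<And>t. \<bar>t\<bar> < \<epsilon> \<Longrightarrow> has_bochner_integral N (\<lambda>x. g x * w x powr t) (\<Phi> t)"
  assumes D: "(\<Phi> has_real_derivative D) (at 0)"
  shows "has_bochner_integral N (\<lambda>x. g x * ln (w x)) D"
proof -
  \<comment> \<open>The difference quotients use orders in (0, d] and their bound needs the orders
    2d and -2d; a third of \<open>\<epsilon>\<close> keeps all of them in range.\<close>
  define d where "d = \<epsilon> / 3"
  define t where "t n = d / real (Suc n)" for n
  define q where "q s x = g x * ((w x powr s - w x powr 0) / s)" for s x
  define b where "b x = (g x * w x powr (2 * d) + g x * w x powr (- 2 * d)) / d" for x
  have d: "0 < d" "2 * d < \<epsilon>"
    using \<open>0 < \<epsilon>\<close> by (auto simp: d_def)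
  have t: "0 < t n" "t n \<le> d" for n
    using d by (auto simp: t_def field_simps)
  have t0: "t \<longlonglongrightarrow> 0"
    unfolding t_def by real_asymp
  have int_q: "has_bochner_integral N (q (t n)) ((\<Phi> (t n) - \<Phi> 0) / t n)" for n
  proof -
    have "has_bochner_integral N (\<lambda>x. (g x * w x powr t n - g x * w x powr 0) / t n)
        ((\<Phi> (t n) - \<Phi> 0) / t n)"
      using t[of n] d by (intro has_bochner_integral_divide_zero has_bochner_integral_diff \<Phi>) auto
    then show ?thesis
      unfolding q_def by (simp add: right_diff_distrib del: powr_zero_eq_one)
  qed
  have b_bound: "AE x in N. norm (q (t n) x) \<le> b x" for n
  proof (rule AE_I2)
    fix x
    show "norm (q (t n) x) \<le> b x"
    proof (cases "w x = 0")
      case True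
      then show ?thesis using g[of x] d by (simp add: q_def b_def)
    next
      case False
      then have "w x > 0" using w[of x] by simp
      then have "\<bar>(w x powr t n - w x powr 0) / t n\<bar> \<le> (w x powr (2 * d) + w x powr (- 2 * d)) / d"
        using abs_exp_diff_quotient_le[OF d(1) t(1) t(2), of n "ln (w x)"] by (simp add: powr_def)
      then have "g x * \<bar>(w x powr t n - w x powr 0) / t n\<bar> \<le>
          g x * ((w x powr (2 * d) + w x powr (- 2 * d)) / d)"
        using g[of x] by (intro mult_left_mono) auto
      then show ?thesis
        using g[of x] by (simp add: q_def b_def abs_mult distrib_left)
    qed
  qed
  have int_b: "integrable N b"
    unfolding b_def using \<Phi>[of "2 * d"] \<Phi>[of "- 2 * d"] d
    by (intro integrable_divide integrable_add) (auto simp: has_bochner_integral_iff)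
  have q_lim: "AE x in N. (\<lambda>n. q (t n) x) \<longlonglongrightarrow> g x * ln (w x)"
  proof (rule AE_I2)
    fix x
    show "(\<lambda>n. q (t n) x) \<longlonglongrightarrow> g x * ln (w x)"
    proof (cases "w x = 0")
      case True
      then show ?thesis by (simp add: q_def)
    next
      case False
      then have "w x > 0" using w[of x] by simp
      then have "((\<lambda>s. w x powr s) has_real_derivative ln (w x)) (at 0)"
        by (auto intro!: derivative_eq_intros)
      then have "((\<lambda>s. (w x powr s - w x powr 0) / s) \<longlongrightarrow> ln (w x)) (at 0)"
        by (simp add: has_field_derivative_iff)
      then have "(\<lambda>n. (w x powr t n - w x powr 0) / t n) \<longlonglongrightarrow> ln (w x)"
        by (rule filterlim_compose) (use t0 t in \<open>auto simp: filterlim_at less_imp_neq[symmetric] intro!: always_eventually\<close>)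
      then show ?thesis
        unfolding q_def by (intro tendsto_intros)
    qed
  qed
  have [measurable]: "q s \<in> borel_measurable N" for s
    unfolding q_def by measurable
  have meas: "(\<lambda>x. g x * ln (w x)) \<in> borel_measurable N" "\<And>n. q (t n) \<in> borel_measurable N"
    by measurable
  note dom = integrable_dominated_convergence[OF meas int_b q_lim b_bound]
    integral_dominated_convergence[OF meas int_b q_lim b_bound]
  have "((\<lambda>s. (\<Phi> s - \<Phi> 0) / s) \<longlongrightarrow> D) (at 0)"
    using D by (simp add: has_field_derivative_iff)
  then have "(\<lambda>n. (\<Phi> (t n) - \<Phi> 0) / t n) \<longlonglongrightarrow> D"
    by (rule filterlim_compose) (use t0 t in \<open>auto simp: filterlim_at less_imp_neq[symmetric] intro!: always_eventually\<close>)
  moreover have "(\<lambda>n. (\<Phi> (t n) - \<Phi> 0) / t n) = (\<lambda>n. integral\<^sup>L N (q (t n)))"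
    using int_q by (simp add: has_bochner_integral_iff)
  ultimately have "integral\<^sup>L N (\<lambda>x. g x * ln (w x)) = D"
    using dom(2) by (simp add: LIMSEQ_unique)
  then show ?thesis
    using dom(1) by (simp add: has_bochner_integral_iff)
qed

section \<open>Versions of the density, and expectations as Lebesgue integrals\<close>

lemma borel_measurable_pdf [measurable]: "pdf M X \<in> borel_measurable borel"
proof -
  have "pdf M X \<in> borel_measurable lborel"
    unfolding pdf_def by measurable
  then show ?thesis by simp
qed

text \<open>The law of \<open>X\<close> is finite, so its Radon-Nikodym derivative is unique up to a
  null set. Any given density may therefore replace \<open>pdf\<close> inside the entropies.\<close>

lemma distributed_pdf:
  fixes X :: "'a \<Rightarrow> 'b::euclidean_space"
  assumes "prob_space M" and X: "distributed M lborel X (\<lambda>x. ennreal (f x))"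
    and f: "\<And>x. 0 \<le> f x"
  shows "AE x in lborel. pdf M X x = f x"
    and "distributed M lborel X (\<lambda>x. ennreal (pdf M X x))"
proof -
  interpret prob_space M by fact
  have [measurable]: "X \<in> measurable M lborel"
    using X by (simp add: distributed_def)
  have "AE x in lborel. ennreal (f x) = RN_deriv lborel (distr M lborel X) x"
  proof (rule RN_deriv_unique_sigma_finite)
    show "sigma_finite_measure (distr M lborel X)"
      by (intro prob_space_imp_sigma_finite prob_space_distr) measurable
  qed (use X in \<open>auto simp: distributed_def\<close>)
  then show eq: "AE x in lborel. pdf M X x = f x"
    by eventually_elim (metis pdf_def enn2real_ennreal f)
  have "density lborel (\<lambda>x. ennreal (f x)) = density lborel (\<lambda>x. ennreal (pdf M X x))"
    using X eq by (intro density_cong) (auto simp: distributed_def)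
  then show "distributed M lborel X (\<lambda>x. ennreal (pdf M X x))"
    using X by (simp add: distributed_def)
qed

lemma distributed_AE_lborel:
  fixes X :: "'a \<Rightarrow> 'b::euclidean_space"
  assumes X: "distributed M lborel X f" and P: "AE x in lborel. P x"
  shows "AE \<omega> in M. P (X \<omega>)"
proof -
  have X': "X \<in> measurable M lborel"
    using X by (simp add: distributed_def)
  have "AE x in density lborel f. P x"
    using P X by (subst AE_density) (auto simp: distributed_def elim: eventually_mono)
  moreover have "distr M lborel X = density lborel f"
    using X by (simp add: distributed_def)
  ultimately have "AE x in distr M lborel X. P x"
    by (simp only:)
  then show ?thesis
    by (rule AE_distrD[OF X'])
qed

lemma distributed_has_bochner_integral:
  fixes X :: "'a \<Rightarrow> 'b::euclidean_space" and h :: "'b \<Rightarrow> real"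
  assumes X: "distributed M lborel X (\<lambda>x. ennreal (f x))" and f: "\<And>x. 0 \<le> f x"
    and h: "h \<in> borel_measurable borel"
    and I: "has_bochner_integral lborel (\<lambda>x. f x * h x) I"
  shows "has_bochner_integral M (\<lambda>\<omega>. h (X \<omega>)) I"
  using distributed_integrable[OF X, where g = h] distributed_integral[OF X, where g = h] f h I
  by (simp add: has_bochner_integral_iff)

text \<open>All one-dimensional forms pass through this rule: existence and value reduce to a single
  Lebesgue integral in natural logarithms. The value \<open>R\<close> enters by an equation, so that
  each family can state its own closed form.\<close>

lemma fp_entropyI:
  assumes M: "prob_space M" and X: "distributed M lborel X (\<lambda>x. ennreal (f x))"
    and f: "\<And>x. 0 \<le> f x" and [measurable]: "f \<in> borel_measurable borel"
    and I: "has_bochner_integral lborel (\<lambda>x. f x * ln (\<bar>x\<bar> * f x)) I"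
    and R: "R = real p - 1/2 - I / ln 2"
  shows "fp_entropy_exists M X \<and> fp_entropy p M X = R"
proof -
  note pdf = distributed_pdf[OF M X f]
  have eq: "AE \<omega> in M. pdf M X (X \<omega>) = f (X \<omega>)"
    by (rule distributed_AE_lborel[OF X pdf(1)])
  have "has_bochner_integral lborel (\<lambda>x. f x * (ln (\<bar>x\<bar> * f x) / ln 2)) (I / ln 2)"
    using has_bochner_integral_divide_zero[OF I, of "ln 2"] by simp
  from distributed_has_bochner_integral[OF X f _ this]
  have "has_bochner_integral M (\<lambda>\<omega>. log 2 (\<bar>X \<omega>\<bar> * f (X \<omega>))) (I / ln 2)"
    by (simp add: log_def)
  moreover have [measurable]: "X \<in> borel_measurable M"
    using X by (simp add: distributed_def)
  ultimately have "has_bochner_integral M (\<lambda>\<omega>. log 2 (\<bar>X \<omega>\<bar> * pdf M X (X \<omega>))) (I / ln 2)"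
    by (subst has_bochner_integral_cong_AE[where g = "\<lambda>\<omega>. log 2 (\<bar>X \<omega>\<bar> * f (X \<omega>))"])
      (use eq in \<open>auto elim: eventually_mono\<close>)
  then show ?thesis
    using pdf(2) R by (simp add: fp_entropy_exists_def fp_entropy_def has_bochner_integral_iff)
qed

text \<open>The integrals of |x|^t f(x)^(1+t) are those behind Renyi entropies, with an extra power
  of |x|; their derivative at \<open>t = 0\<close> is the Shannon-type integral.\<close>

lemma fp_entropy_renyi:
  assumes "prob_space M" and "distributed M lborel X (\<lambda>x. ennreal (f x))"
    and "\<And>x. 0 \<le> f x" and [measurable]: "f \<in> borel_measurable borel"
    and "0 < \<epsilon>"
    and "\<And>t. \<bar>t\<bar> < \<epsilon> \<Longrightarrow> has_bochner_integral lborel (\<lambda>x. f x * (\<bar>x\<bar> * f x) powr t) (\<Phi> t)"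
    and "(\<Phi> has_real_derivative D) (at 0)"
    and "R = real p - 1/2 - D / ln 2"
  shows "fp_entropy_exists M X \<and> fp_entropy p M X = R"
  using assms by (intro fp_entropyI[where f = f and I = D] has_bochner_integral_ln_moment[where \<Phi> = \<Phi>]) auto

text \<open>The classical Gamma, Beta and power integrals enter as gauge integrals; nonnegativity on
  \<open>S\<close> makes them absolutely convergent.\<close>

lemma has_bochner_integral_of_has_integral:
  fixes f :: "real \<Rightarrow> real"
  assumes [measurable]: "f \<in> borel_measurable borel" "S \<in> sets borel"
    and "\<And>x. x \<in> S \<Longrightarrow> 0 \<le> f x" and I: "(f has_integral I) S"
  shows "has_bochner_integral lborel (\<lambda>x. indicator S x * f x) I"
proof -
  have "(\<lambda>x. indicator S x * f x) = (\<lambda>x. if x \<in> S then f x else 0)"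
    by (auto simp: indicator_def)
  then have "((\<lambda>x. indicator S x * f x) has_integral I) UNIV"
    using I by (simp add: has_integral_restrict_UNIV)
  moreover have "0 \<le> I"
    using assms by (auto intro: has_integral_nonneg)
  ultimately show ?thesis
    using assms(3) by (intro has_bochner_integral_nn_integral nn_integral_has_integral_lborel)
      (auto simp: indicator_def)
qed

text \<open>An equivalence, so that integrability is transferred along with the value. Only
  injectivity of \<open>g\<close> is assumed, hence the absolute value of the derivative.\<close>

lemma has_bochner_integral_substitution:
  fixes f g g' :: "real \<Rightarrow> real"
  assumes [measurable]: "f \<in> borel_measurable borel" "g \<in> borel_measurable borel" "g' \<in> borel_measurable borel"
    "S \<in> sets borel" "g ` S \<in> sets borel"
    and "\<And>x. x \<in> S \<Longrightarrow> (g has_real_derivative g' x) (at x)" and "inj_on g S"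
  shows "has_bochner_integral lborel (\<lambda>x. indicator S x * (\<bar>g' x\<bar> * f (g x))) b \<longleftrightarrow>
    has_bochner_integral lborel (\<lambda>y. indicator (g ` S) y * f y) b"
proof -
  \<comment> \<open>The change of variables speaks of absolute integrability for the completed
    Lebesgue measure; for Borel functions the completion changes nothing.\<close>
  have *: "has_bochner_integral lborel (\<lambda>x. indicator A x * h x) b \<longleftrightarrow>
      h absolutely_integrable_on A \<and> integral A h = b"
    if [measurable]: "h \<in> borel_measurable borel" "A \<in> sets borel" for h :: "real \<Rightarrow> real" and A
  proof -
    have "h absolutely_integrable_on A \<longleftrightarrow> integrable lborel (\<lambda>x. indicator A x * h x)"
      unfolding set_integrable_def by (subst integrable_completion) auto
    moreover have "integral A h = (\<integral>x. indicator A x * h x \<partial>lborel)"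
      if "integrable lborel (\<lambda>x. indicator A x * h x)"
      using set_borel_integral_eq_integral(2)[of A h] that
      by (simp add: set_integrable_def set_lebesgue_integral_def)
    ultimately show ?thesis
      by (auto simp: has_bochner_integral_iff)
  qed
  show ?thesis
    using has_absolute_integral_change_of_variables_1'[of S g g' f b] assms
    by (subst (1 2) *) (simp_all add: has_field_derivative_at_within)
qed


section \<open>Generalized gamma densities\<close>

text \<open>Testing against the constant 1. The total mass of a density is thus obtained without
  calculus and later fixes unknown constants.\<close>

lemma distributed_integral_eq_1:
  fixes X :: "'a \<Rightarrow> 'b::euclidean_space"
  assumes "prob_space M" and X: "distributed M lborel X (\<lambda>x. ennreal (f x))" and f: "\<And>x. 0 \<le> f x"
  shows "has_bochner_integral lborel f 1"
proof -
  interpret prob_space M by fact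
  show ?thesis
    using distributed_integrable[OF X, where g = "\<lambda>_. 1"] distributed_integral[OF X, where g = "\<lambda>_. 1"] f
    by (simp add: has_bochner_integral_iff prob_space)
qed

text \<open>Leaving 0 out of the half line changes no integral and spares the formulas the values of
  \<open>powr\<close> and \<open>ln\<close> at 0.\<close>

lemma has_bochner_integral_even_function':
  fixes f :: "real \<Rightarrow> real"
  assumes f: "has_bochner_integral lborel (\<lambda>x. indicator {0<..} x * f x) I"
    and even: "\<And>x. f (- x) = f x"
  shows "has_bochner_integral lborel f (2 * I)"
proof -
  have "has_bochner_integral lborel (\<lambda>x. indicator {0..} x *\<^sub>R f x) I"
    using f by (subst has_bochner_integral_discrete_difference[where X = "{0}" and g = "\<lambda>x. indicator {0<..} x * f x"])
      (auto split: split_indicator)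
  from has_bochner_integral_even_function[OF this even] show ?thesis
    by simp
qed

lemma has_bochner_integral_Gamma:
  fixes r :: real
  assumes "0 < r"
  shows "has_bochner_integral lborel (\<lambda>x. indicator {0<..} x * (x powr (r - 1) * exp (- x))) (Gamma r)"
proof -
  have "has_bochner_integral lborel (\<lambda>x. indicator {0..} x * (x powr (r - 1) / exp x)) (Gamma r)"
    using Gamma_integral_real[OF assms] by (intro has_bochner_integral_of_has_integral) auto
  moreover have "indicator {0..} x * (x powr (r - 1) / exp x) =
      indicator {0<..} x * (x powr (r - 1) * exp (- x))" for x :: real
    by (auto simp: indicator_def exp_minus field_simps)
  ultimately show ?thesis
    by simp
qed

text \<open>The substitution y = c x^k leads to the Gamma integral at \<open>a / k\<close>.\<close>

lemma has_bochner_integral_generalized_Gamma: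
  fixes a c k :: real
  assumes "0 < a" "0 < c" "0 < k"
  shows "has_bochner_integral lborel
    (\<lambda>x. indicator {0<..} x * (x powr (a - 1) * exp (- c * x powr k)))
    (Gamma (a / k) * c powr (- (a / k)) / k)"
proof -
  define r where "r = a / k"
  have r: "0 < r" "a = r * k"
    using assms by (auto simp: r_def)
  define g where "g x = c * x powr k" for x
  define g' where "g' x = c * (k * x powr (k - 1))" for x
  have [measurable]: "g \<in> borel_measurable borel" "g' \<in> borel_measurable borel"
    unfolding g_def g'_def by measurable
  have image: "g ` {0<..} = {0<..}"
  proof (intro set_eqI iffI)
    fix y :: real assume "y \<in> {0<..}"
    then have "y = g ((y / c) powr (1 / k))" "(y / c) powr (1 / k) \<in> {0<..}"
      using assms by (auto simp: g_def powr_powr)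
    then show "y \<in> g ` {0<..}" by blast
  qed (use assms in \<open>auto simp: g_def\<close>)
  have inj: "inj_on g {0<..}"
  proof (rule inj_on_inverseI)
    fix x :: real assume "x \<in> {0<..}"
    then show "(g x / c) powr (1 / k) = x"
      using assms by (auto simp: g_def powr_powr)
  qed
  have "has_bochner_integral lborel
      (\<lambda>x. indicator {0<..} x * (\<bar>g' x\<bar> * (g x powr (r - 1) * exp (- g x)))) (Gamma r)"
    using has_bochner_integral_Gamma[OF r(1)] inj
    by (subst has_bochner_integral_substitution[where g = g and f = "\<lambda>y. y powr (r - 1) * exp (- y)"])
      (auto simp: image, auto simp: g_def[abs_def] g'_def intro!: derivative_eq_intros)
  then have "has_bochner_integral lborel
      (\<lambda>x. indicator {0<..} x * (\<bar>g' x\<bar> * (g x powr (r - 1) * exp (- g x))) * (c powr (- r) / k))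
      (Gamma r * (c powr (- r) / k))"
    by (intro has_bochner_integral_mult_left)
  \<comment> \<open>As \<open>a = r * k\<close>, the transformed integrand is
    \<open>k * c powr r * x powr (a - 1)\<close> times the exponential; the last factor removes the
    constant.\<close>
  moreover have "indicator {0<..} x * (\<bar>g' x\<bar> * (g x powr (r - 1) * exp (- g x))) * (c powr (- r) / k) =
      indicator {0<..} x * (x powr (a - 1) * exp (- c * x powr k))" for x
  proof (cases "0 < x")
    case True
    have "c * c powr (r - 1) * c powr (- r) = 1"
      using assms by (simp add: powr_mult_base flip: powr_add)
    moreover have "x powr (k - 1) * (x powr k) powr (r - 1) = x powr (a - 1)"
      using True by (simp add: powr_powr r algebra_simps flip: powr_add)
    ultimately have "c * (k * x powr (k - 1)) * ((c * x powr k) powr (r - 1)) * (c powr (- r) / k) = x powr (a - 1)"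
      using assms True by (simp add: powr_mult mult_ac)
    then show ?thesis
      using assms True by (simp add: g_def g'_def mult_ac)
  qed auto
  ultimately show ?thesis
    by (simp add: r_def)
qed

text \<open>The integral of f(x) (x f(x))^t over the positive half line for f(x) = K x^(a-1) exp(-c
  x^k). Since x f(x) = K x^a exp(-c x^k), the integrand is of the same shape with a and c both
  multiplied by 1 + t; without the factor x the first exponent would not scale this way.\<close>

definition generalized_gamma_moment :: "real \<Rightarrow> real \<Rightarrow> real \<Rightarrow> real \<Rightarrow> real \<Rightarrow> real" where
  "generalized_gamma_moment K a c k t =
     K powr (1 + t) * (Gamma (a / k * (1 + t)) * (c * (1 + t)) powr (- (a / k * (1 + t))) / k)"

lemma has_bochner_integral_generalized_gamma_moment:
  fixes a c k K t :: real
  assumes "0 < a" "0 < c" "0 < k" "0 < K" "\<bar>t\<bar> < 1"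
    and f: "\<And>x. 0 < x \<Longrightarrow> f x = K * x powr (a - 1) * exp (- c * x powr k)"
  shows "has_bochner_integral lborel
    (\<lambda>x. indicator {0<..} x * (f x * (\<bar>x\<bar> * f x) powr t)) (generalized_gamma_moment K a c k t)"
proof -
  have "has_bochner_integral lborel
    (\<lambda>x. K powr (1 + t) * (indicator {0<..} x * (x powr (a * (1 + t) - 1) * exp (- (c * (1 + t)) * x powr k))))
    (generalized_gamma_moment K a c k t)"
    unfolding generalized_gamma_moment_def
    using assms has_bochner_integral_generalized_Gamma[of "a * (1 + t)" "c * (1 + t)" k]
    by (intro has_bochner_integral_mult_right) simp
  moreover have "K powr (1 + t) * (indicator {0<..} x * (x powr (a * (1 + t) - 1) * exp (- (c * (1 + t)) * x powr k)))
    = indicator {0<..} x * (f x * (\<bar>x\<bar> * f x) powr t)" for x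
  proof (cases "0 < x")
    case True
    have "f x = exp (ln K + (a - 1) * ln x - c * x powr k)"
      using True assms by (simp add: f exp_add exp_diff powr_def exp_minus field_simps)
    moreover have "\<bar>x\<bar> * f x = exp (ln K + a * ln x - c * x powr k)"
      using True by (simp add: calculation exp_diff exp_add algebra_simps)
    moreover have "K powr (1 + t) * (x powr (a * (1 + t) - 1) * exp (- (c * (1 + t)) * x powr k)) =
      exp ((1 + t) * ln K + (a * (1 + t) - 1) * ln x - c * (1 + t) * x powr k)"
      using True assms by (simp add: exp_add exp_diff powr_def exp_minus field_simps)
    ultimately show ?thesis
      using True by (simp add: powr_def[of "exp _"] algebra_simps flip: exp_add)
  qed auto
  ultimately show ?thesis
    by (simp only:)
qed

text \<open>Logarithmic differentiation. The final \<open>- a / k\<close> comes from the base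
  \<open>c * (1 + t)\<close> of the power, \<open>- a / k * ln c\<close> from its exponent.\<close>

lemma has_real_derivative_generalized_gamma_moment:
  assumes "0 < a" "0 < c" "0 < k" "0 < K"
  shows "(generalized_gamma_moment K a c k has_real_derivative
    generalized_gamma_moment K a c k 0 * (ln K + a / k * Digamma (a / k) - a / k * ln c - a / k)) (at 0)"
proof -
  define r where "r = a / k"
  have r: "0 < r" "r \<notin> \<int>\<^sub>\<le>\<^sub>0"
    using assms by (auto simp: r_def) (meson divide_pos_pos nonpos_Ints_nonpos not_le)
  show ?thesis
    unfolding generalized_gamma_moment_def[abs_def] r_def[symmetric]
    using r assms
    apply (auto intro!: derivative_eq_intros DERIV_powr)
    apply (simp add: field_simps powr_minus)
    done
qed

text \<open>Serves the Gamma, chi-square and Weibull laws. Only \<open>r\<close> and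
  \<open>k\<close> survive, because \<open>c\<close> enters \<open>ln K\<close> as
  \<open>r * ln c\<close> and this cancels in the derivative.\<close>

lemma fp_entropy_generalized_gamma:
  assumes M: "prob_space M" and X: "distributed M lborel X (\<lambda>x. ennreal (f x))"
    and [measurable]: "f \<in> borel_measurable borel"
    and pos: "0 < a" "0 < c" "0 < k" "0 < K"
    and f: "\<And>x. 0 < x \<Longrightarrow> f x = K * x powr (a - 1) * exp (- c * x powr k)"
    and f0: "\<And>x. x \<le> 0 \<Longrightarrow> f x = 0"
    and r: "r = a / k"
    and R: "R = real p - 1/2 + (r - r * Digamma r + ln (Gamma r) - ln k) / ln 2"
  shows "fp_entropy_exists M X \<and> fp_entropy p M X = R"
proof -
  have nn: "0 \<le> f x" for x
    using pos by (cases "0 < x") (auto simp: f f0)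
  have mom: "has_bochner_integral lborel (\<lambda>x. f x * (\<bar>x\<bar> * f x) powr t) (generalized_gamma_moment K a c k t)"
    if "\<bar>t\<bar> < 1" for t
  proof -
    have "indicator {0<..} x * (f x * (\<bar>x\<bar> * f x) powr t) = f x * (\<bar>x\<bar> * f x) powr t" for x
      by (cases "0 < x") (auto simp: f0)
    then show ?thesis
      using has_bochner_integral_generalized_gamma_moment[OF pos that f] by (simp only:)
  qed
  \<comment> \<open>At \<open>t = 0\<close> the convention \<open>0 powr 0 = 0\<close> does no harm:
    \<open>\<bar>x\<bar> * f x\<close> vanishes only where \<open>f x\<close> does.\<close>
  have "f x * (\<bar>x\<bar> * f x) powr 0 = f x" for x
    using pos by (cases "0 < x") (auto simp: f f0)
  then have one: "generalized_gamma_moment K a c k 0 = 1"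
    using mom[of 0] distributed_integral_eq_1[OF M X nn]
    by (simp only: has_bochner_integral_iff abs_zero zero_less_one)
  have r': "0 < r" using r pos by simp
  then have Gamma_r: "0 < Gamma r" by simp
  \<comment> \<open>The constant is read off from the total mass 1.\<close>
  from one have "K = k * c powr r / Gamma r"
    using pos r' Gamma_r less_imp_neq[OF Gamma_r] by (simp add: generalized_gamma_moment_def powr_minus field_simps flip: r)
  then have "ln K = ln k + r * ln c - ln (Gamma r)"
    using pos r' Gamma_r less_imp_neq[OF Gamma_r] by (simp add: ln_div ln_mult ln_powr)
  with has_real_derivative_generalized_gamma_moment[OF pos] one
  have "(generalized_gamma_moment K a c k has_real_derivative ln k - ln (Gamma r) + r * Digamma r - r) (at 0)"
    by (simp add: algebra_simps flip: r)
  from fp_entropy_renyi[OF M X nn _ zero_less_one mom this] show ?thesis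
    using R by (simp add: field_simps)
qed

text \<open>Serves the normal law (\<open>k = 2\<close>) and the Laplace law (\<open>k = 1\<close>),
  both with \<open>a = 1\<close>. The formula for \<open>f\<close> excludes 0, where
  \<open>\<bar>x\<bar> powr (a - 1)\<close> would be \<open>0 powr 0 = 0\<close>. The term
  \<open>- ln 2\<close> arises because each half line carries mass 1/2.\<close>

lemma has_bochner_integral_symmetric_generalized_gamma:
  fixes f :: "real \<Rightarrow> real"
  assumes one: "has_bochner_integral lborel f 1"
    and [measurable]: "f \<in> borel_measurable borel"
    and pos: "0 < a" "0 < c" "0 < k" "0 < K"
    and f: "\<And>x. x \<noteq> 0 \<Longrightarrow> f x = K * \<bar>x\<bar> powr (a - 1) * exp (- c * \<bar>x\<bar> powr k)"
    and f0: "0 < f 0"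
    and r: "r = a / k"
  shows "has_bochner_integral lborel (\<lambda>x. f x * ln (\<bar>x\<bar> * f x))
    (ln k - ln (Gamma r) - ln 2 + r * Digamma r - r)"
proof -
  have fpos: "0 < f x" for x
    using pos f0 by (cases "x = 0") (auto simp: f)
  have even: "f (- x) = f x" for x
    by (cases "x = 0") (auto simp: f)
  have mom: "has_bochner_integral lborel (\<lambda>x. f x * (\<bar>x\<bar> * f x) powr t) (2 * generalized_gamma_moment K a c k t)"
    if "\<bar>t\<bar> < 1" for t
    by (rule has_bochner_integral_even_function'[OF has_bochner_integral_generalized_gamma_moment[OF pos that]])
      (auto simp: f even)
  \<comment> \<open>At 0 the left-hand side is 0 while \<open>f 0\<close> is positive, so the
    identity holds only almost everywhere.\<close>
  have "AE x in lborel. f x * (\<bar>x\<bar> * f x) powr 0 = f x"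
    using AE_lborel_singleton[of "0::real"]
    by (rule eventually_mono) (simp add: less_imp_neq[OF fpos, symmetric])
  then have "has_bochner_integral lborel f (2 * generalized_gamma_moment K a c k 0)"
    using mom[of 0] by (subst has_bochner_integral_cong_AE[symmetric]) auto
  then have one: "generalized_gamma_moment K a c k 0 = 1 / 2"
    using one by (simp add: has_bochner_integral_iff)
  have r': "0 < r" using r pos by simp
  then have Gamma_r: "0 < Gamma r" by simp
  from one have "K = k * c powr r / Gamma r / 2"
    using pos r' Gamma_r less_imp_neq[OF Gamma_r] by (simp add: generalized_gamma_moment_def powr_minus field_simps flip: r)
  then have "ln K = ln k + r * ln c - ln (Gamma r) - ln 2"
    using pos r' Gamma_r less_imp_neq[OF Gamma_r] by (simp add: ln_div ln_mult ln_powr)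
  with DERIV_cmult[OF has_real_derivative_generalized_gamma_moment[OF pos], of 2] one
  have "((\<lambda>t. 2 * generalized_gamma_moment K a c k t) has_real_derivative ln k - ln (Gamma r) - ln 2 + r * Digamma r - r) (at 0)"
    by (simp add: algebra_simps flip: r)
  from has_bochner_integral_ln_moment[OF _ _ _ _ zero_less_one mom this] show ?thesis
    using fpos by (simp add: less_imp_le)
qed


section \<open>Uniform, Pareto and Beta distributions\<close>

lemma fp_entropy_uniform:
  assumes M: "prob_space M" and X: "distributed M lborel X (\<lambda>x. ennreal (uniform_density (- a) a x))"
    and a: "0 < a"
  shows "fp_entropy_exists M X \<and> fp_entropy p M X = real p + 1/2 + log 2 (exp 1)"
proof -
  let ?f = "uniform_density (- a) a"
  define C where "C = 1 / (2 * a)"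
  have C: "0 < C" "C * (2 * a) = 1" using a by (auto simp: C_def)
  have f_eq: "?f x = C * indicator {- a..a} x" for x
    using a by (simp add: uniform_density_def C_def)
  have nn: "0 \<le> ?f x" for x
    using C by (simp add: f_eq)
  have mom: "has_bochner_integral lborel (\<lambda>x. ?f x * (\<bar>x\<bar> * ?f x) powr t)
      (2 * ((C * a) powr (1 + t) / (1 + t)))" if t: "\<bar>t\<bar> < 1" for t
  proof (rule has_bochner_integral_even_function')
    have "has_bochner_integral lborel (\<lambda>x. C powr (1 + t) * (indicator {0..a} x * x powr t))
        (C powr (1 + t) * (a powr (t + 1) / (t + 1)))"
      using t a has_integral_powr_from_0[of t a]
      by (intro has_bochner_integral_mult_right has_bochner_integral_of_has_integral) auto
    moreover have "C powr (1 + t) * (indicator {0..a} x * x powr t) =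
        indicator {0<..} x * (?f x * (\<bar>x\<bar> * ?f x) powr t)" for x
      using C by (auto simp: f_eq indicator_def powr_mult powr_add)
    ultimately show "has_bochner_integral lborel (\<lambda>x. indicator {0<..} x * (?f x * (\<bar>x\<bar> * ?f x) powr t))
        ((C * a) powr (1 + t) / (1 + t))"
      using C a by (simp add: powr_mult add.commute)
  qed (auto simp: f_eq indicator_def)
  \<comment> \<open>\<open>C * a\<close> equals 1/2, so the half-width \<open>a\<close> disappears
    from the moment and from its derivative.\<close>
  have "((\<lambda>t. 2 * ((C * a) powr (1 + t) / (1 + t))) has_real_derivative
      2 * (C * a) * (ln (C * a) - 1)) (at 0)"
    using C a by (auto intro!: derivative_eq_intros simp: algebra_simps)
  moreover have "2 * (C * a) * (ln (C * a) - 1) = - ln 2 - 1"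
    using a by (simp add: C_def ln_div)
  ultimately have D: "((\<lambda>t. 2 * ((C * a) powr (1 + t) / (1 + t))) has_real_derivative - ln 2 - 1) (at 0)"
    by (simp only:)
  have [measurable]: "?f \<in> borel_measurable borel"
    unfolding uniform_density_def[abs_def] by measurable
  show ?thesis
    by (rule fp_entropy_renyi[OF M X nn _ zero_less_one mom D]) (auto simp: log_def field_simps)
qed

lemma fp_entropy_pareto:
  assumes M: "prob_space M" and X: "distributed M lborel X (\<lambda>x. ennreal (pareto_density m \<alpha> x))"
    and pos: "0 < m" "0 < \<alpha>"
  shows "fp_entropy_exists M X \<and> fp_entropy p M X = real p - 1/2 + log 2 (exp 1 / \<alpha>)"
proof -
  let ?f = "pareto_density m \<alpha>"
  have nn: "0 \<le> ?f x" for x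
    using pos by (simp add: pareto_density_def)
  have mom: "has_bochner_integral lborel (\<lambda>x. ?f x * (\<bar>x\<bar> * ?f x) powr t) (\<alpha> powr t / (1 + t))"
    if t: "\<bar>t\<bar> < 1" for t
  proof -
    have e: "0 < \<alpha> * (1 + t)"
      using t pos by auto
    have "has_bochner_integral lborel
        (\<lambda>x. (\<alpha> * m powr \<alpha>) powr (1 + t) * (indicator {m..} x * x powr (- \<alpha> * (1 + t) - 1)))
        ((\<alpha> * m powr \<alpha>) powr (1 + t) * (- (m powr (- \<alpha> * (1 + t) - 1 + 1)) / (- \<alpha> * (1 + t) - 1 + 1)))"
      using t pos e has_integral_powr_to_inf[of "- \<alpha> * (1 + t) - 1" m]
      by (intro has_bochner_integral_mult_right has_bochner_integral_of_has_integral) auto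
    moreover have "(\<alpha> * m powr \<alpha>) powr (1 + t) * (indicator {m..} x * x powr (- \<alpha> * (1 + t) - 1)) =
        ?f x * (\<bar>x\<bar> * ?f x) powr t" for x
    proof (cases "m \<le> x")
      case True
      then have x: "0 < x" using pos by simp
      then have "?f x = exp (ln \<alpha> + \<alpha> * ln m + (- \<alpha> - 1) * ln x)"
        using True pos by (simp add: pareto_density_def powr_def exp_add)
      moreover from this have "\<bar>x\<bar> * ?f x = exp (ln \<alpha> + \<alpha> * ln m - \<alpha> * ln x)"
        using x by (simp add: algebra_simps exp_diff exp_add)
      moreover have "\<alpha> * m powr \<alpha> = exp (ln \<alpha> + \<alpha> * ln m)"
        using pos by (simp add: powr_def exp_add)
      ultimately show ?thesis
        using True x by (simp add: powr_def algebra_simps flip: exp_add)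
    qed (auto simp: pareto_density_def)
    \<comment> \<open>The powers of \<open>m\<close> cancel, which leaves a moment free of the
      scale.\<close>
    moreover have "(\<alpha> * m powr \<alpha>) powr (1 + t) * (- (m powr (- \<alpha> * (1 + t) - 1 + 1)) / (- \<alpha> * (1 + t) - 1 + 1))
        = \<alpha> powr t / (1 + t)"
    proof -
      have "(m powr \<alpha>) powr (1 + t) * m powr (- \<alpha> * (1 + t)) = 1"
        using pos by (simp add: powr_powr flip: powr_add)
      moreover have "\<alpha> powr (1 + t) = \<alpha> * \<alpha> powr t"
        using pos by (simp add: powr_add)
      moreover have "- \<alpha> * (1 + t) - 1 + 1 = - (\<alpha> * (1 + t))"
        by simp
      ultimately show ?thesis
        using pos t by (simp add: powr_mult mult_ac del: ring_distribs)
    qed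
    ultimately show ?thesis
      by (simp only:)
  qed
  have D: "((\<lambda>t. \<alpha> powr t / (1 + t)) has_real_derivative ln \<alpha> - 1) (at 0)"
    using pos by (auto intro!: derivative_eq_intros)
  have [measurable]: "?f \<in> borel_measurable borel"
    unfolding pareto_density_def[abs_def] by measurable
  show ?thesis
    using pos by (intro fp_entropy_renyi[OF M X nn _ zero_less_one mom D])
      (auto simp: log_def ln_div field_simps)
qed

section \<open>Beta integrals, their derivatives, and the Beta law\<close>

lemma has_bochner_integral_Beta:
  fixes a b :: real
  assumes "0 < a" "0 < b"
  shows "has_bochner_integral lborel (\<lambda>x. indicator {0<..<1} x * (x powr (a - 1) * (1 - x) powr (b - 1))) (Beta a b)"
proof -
  have "has_bochner_integral lborel (\<lambda>x. indicator {0..1} x * (x powr (a - 1) * (1 - x) powr (b - 1))) (Beta a b)"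
    using has_integral_Beta_real[OF assms] by (intro has_bochner_integral_of_has_integral) auto
  moreover have "indicator {0..1} x * (x powr (a - 1) * (1 - x) powr (b - 1)) =
      indicator {0<..<1} x * (x powr (a - 1) * (1 - x) powr (b - 1))" for x
    by (cases "x = 0 \<or> x = 1") (auto simp: indicator_def)
  ultimately show ?thesis
    by (simp only:)
qed

lemma Beta_pos_real: "0 < a \<Longrightarrow> 0 < b \<Longrightarrow> 0 < Beta a (b::real)"
  by (simp add: Beta_def)

lemma has_real_derivative_Beta_affine:
  assumes "0 < a" "0 < b"
  shows "((\<lambda>t. Beta (a + u * t) (b + v * t)) has_real_derivative
    Beta a b * (u * Digamma a + v * Digamma b - (u + v) * Digamma (a + b))) (at 0)"
proof -
  have *: "a \<notin> \<int>\<^sub>\<le>\<^sub>0" "b \<notin> \<int>\<^sub>\<le>\<^sub>0" "a + b \<notin> \<int>\<^sub>\<le>\<^sub>0"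
    using assms by (meson add_pos_pos nonpos_Ints_nonpos not_le)+
  moreover have "Gamma (a + b) \<noteq> 0"
    using assms by (simp add: less_imp_neq[symmetric])
  ultimately show ?thesis
    unfolding Beta_def by (auto intro!: derivative_eq_intros simp: divide_simps) (simp add: algebra_simps)
qed

text \<open>The common form of the moments below: the normalizing constant to the power 1 + t, and
  Beta arguments moving at their own rates. The rates are \<open>(\<alpha>, \<beta> - 1)\<close> for
  the Beta law, \<open>(1 / 2, \<nu> / 2)\<close> for Student's law and \<open>(1, 1)\<close> for
  the logistic entropy.\<close>

lemma has_real_derivative_normalized_Beta:
  assumes "0 < a" "0 < b"
  shows "((\<lambda>t. Beta a b powr (- 1 - t) * Beta (a + u * t) (b + v * t)) has_real_derivative
    - ln (Beta a b) + (u * Digamma a + v * Digamma b - (u + v) * Digamma (a + b))) (at 0)"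
proof -
  define B where "B = Beta a b"
  have B: "0 < B"
    using assms by (simp add: B_def Beta_pos_real)
  have "((\<lambda>t. B powr (- 1 - t)) has_real_derivative - ln B / B) (at 0)"
    using B by (auto intro!: derivative_eq_intros simp: powr_minus field_simps)
  from DERIV_mult[OF this has_real_derivative_Beta_affine[OF assms, of u v, folded B_def]]
  have "((\<lambda>t. B powr (- 1 - t) * Beta (a + u * t) (b + v * t)) has_real_derivative
      - ln B / B * B + B * (u * Digamma a + v * Digamma b - (u + v) * Digamma (a + b)) * B powr - 1) (at 0)"
    by (simp add: B_def)
  moreover have "- ln B / B * B + B * (u * Digamma a + v * Digamma b - (u + v) * Digamma (a + b)) * B powr - 1 =
      - ln B + (u * Digamma a + v * Digamma b - (u + v) * Digamma (a + b))"
    using B by (simp add: powr_minus field_simps)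
  ultimately show ?thesis
    by (simp only: B_def)
qed

lemma fp_entropy_beta:
  assumes M: "prob_space M" and X: "distributed M lborel X (\<lambda>x. ennreal (beta_density \<alpha> \<beta> x))"
    and pos: "0 < \<alpha>" "0 < \<beta>"
  shows "fp_entropy_exists M X \<and> fp_entropy p M X = real p - 1/2 + log 2 (Beta \<alpha> \<beta>)
    + ((\<alpha> + \<beta> - 1) * Digamma (\<alpha> + \<beta>) - \<alpha> * Digamma \<alpha> - (\<beta> - 1) * Digamma \<beta>) / ln 2"
proof -
  let ?f = "beta_density \<alpha> \<beta>"
  \<comment> \<open>The factor |x| raises only the power of x, so the second Beta argument is
    \<open>\<beta> + (\<beta> - 1) * t\<close>. For \<open>\<beta> < 1\<close> the bound
    \<open>\<bar>t\<bar> < \<beta>\<close> keeps it positive; otherwise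
    \<open>\<bar>t\<bar> < 1\<close> does.\<close>
  define \<epsilon> where "\<epsilon> = min 1 \<beta>"
  define B where "B = Beta \<alpha> \<beta>"
  have B: "0 < B"
    using pos by (simp add: B_def Beta_pos_real)
  have \<epsilon>: "0 < \<epsilon>"
    using pos by (simp add: \<epsilon>_def)
  have nn: "0 \<le> ?f x" for x
    using B by (simp add: beta_density_def flip: B_def)
  have mom: "has_bochner_integral lborel (\<lambda>x. ?f x * (\<bar>x\<bar> * ?f x) powr t)
      (B powr (- 1 - t) * Beta (\<alpha> + \<alpha> * t) (\<beta> + (\<beta> - 1) * t))" if t: "\<bar>t\<bar> < \<epsilon>" for t
  proof -
    have a: "0 < \<alpha> + \<alpha> * t"
    proof -
      have "\<alpha> + \<alpha> * t = \<alpha> * (1 + t)" by (simp add: algebra_simps)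
      moreover have "0 < 1 + t" using t unfolding \<epsilon>_def by linarith
      ultimately show ?thesis using pos by simp
    qed
    have b: "0 < \<beta> + (\<beta> - 1) * t"
    proof (cases "1 \<le> \<beta>")
      case True
      have "(\<beta> - 1) * (- 1) \<le> (\<beta> - 1) * t"
        using True t by (intro mult_left_mono) (auto simp: \<epsilon>_def)
      then show ?thesis by simp
    next
      case False
      have "\<bar>(\<beta> - 1) * t\<bar> \<le> 1 * \<bar>t\<bar>"
        unfolding abs_mult using False pos by (intro mult_right_mono) auto
      then show ?thesis using t unfolding \<epsilon>_def by linarith
    qed
    have "has_bochner_integral lborel (\<lambda>x. B powr (- 1 - t) *
        (indicator {0<..<1} x * (x powr (\<alpha> + \<alpha> * t - 1) * (1 - x) powr (\<beta> + (\<beta> - 1) * t - 1))))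
        (B powr (- 1 - t) * Beta (\<alpha> + \<alpha> * t) (\<beta> + (\<beta> - 1) * t))"
      by (intro has_bochner_integral_mult_right has_bochner_integral_Beta a b)
    moreover have "B powr (- 1 - t) *
        (indicator {0<..<1} x * (x powr (\<alpha> + \<alpha> * t - 1) * (1 - x) powr (\<beta> + (\<beta> - 1) * t - 1))) =
        ?f x * (\<bar>x\<bar> * ?f x) powr t" for x
    proof (cases "0 < x \<and> x < 1")
      case True
      then have "?f x = exp ((\<alpha> - 1) * ln x + (\<beta> - 1) * ln (1 - x) - ln B)"
        using B by (simp add: beta_density_def powr_def exp_add exp_diff flip: B_def)
      moreover from this have "\<bar>x\<bar> * ?f x = exp (ln x + ((\<alpha> - 1) * ln x + (\<beta> - 1) * ln (1 - x) - ln B))"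
        using True by (subst exp_add) simp
      ultimately show ?thesis
        using True B by (simp add: powr_def algebra_simps flip: exp_add)
    qed (auto simp: beta_density_def)
    ultimately show ?thesis
      by (simp only:)
  qed
  have D: "((\<lambda>t. B powr (- 1 - t) * Beta (\<alpha> + \<alpha> * t) (\<beta> + (\<beta> - 1) * t)) has_real_derivative
     - ln B + (\<alpha> * Digamma \<alpha> + (\<beta> - 1) * Digamma \<beta> - (\<alpha> + \<beta> - 1) * Digamma (\<alpha> + \<beta>))) (at 0)"
    using has_real_derivative_normalized_Beta[OF pos, of \<alpha> "\<beta> - 1"] by (simp add: B_def add_diff_eq)
  have [measurable]: "?f \<in> borel_measurable borel"
    unfolding beta_density_def[abs_def] by measurable
  show ?thesis
    by (intro fp_entropy_renyi[OF M X nn _ \<epsilon> mom D]) (auto simp: log_def field_simps B_def)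
qed


section \<open>Lognormal and Student distributions\<close>

text \<open>Inside the logarithm, \<open>\<bar>x\<bar> * (f (x / s) / s)\<close> is
  \<open>\<bar>y\<bar> * f y\<close> at \<open>y = x / s\<close>, and the Jacobian absorbs the
  remaining factor \<open>1 / s\<close>. So the integral of the unscaled density serves every
  scale.\<close>

lemma fp_entropy_scaleI:
  assumes M: "prob_space M" and X: "distributed M lborel X (\<lambda>x. ennreal (f (x / s) / s))"
    and s: "0 < s" and f: "\<And>x. 0 \<le> f x" and [measurable]: "f \<in> borel_measurable borel"
    and I: "has_bochner_integral lborel (\<lambda>x. f x * ln (\<bar>x\<bar> * f x)) I"
    and R: "R = real p - 1/2 - I / ln 2"
  shows "fp_entropy_exists M X \<and> fp_entropy p M X = R"
proof (rule fp_entropyI[OF M X _ _ _ R])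
  have "has_bochner_integral lborel (\<lambda>x. f (0 + 1 / s * x) * ln (\<bar>0 + 1 / s * x\<bar> * f (0 + 1 / s * x)) / s)
      (I /\<^sub>R \<bar>1 / s\<bar> / s)"
    using I s
    by (intro has_bochner_integral_divide_zero lborel_has_bochner_integral_real_affine_iff[THEN iffD1]) auto
  then show "has_bochner_integral lborel (\<lambda>x. f (x / s) / s * ln (\<bar>x\<bar> * (f (x / s) / s))) I"
    using s by (simp add: abs_mult)
qed (use f s in auto)

text \<open>\<open>lognormal_distributed\<close> prescribes the law of \<open>ln X\<close>; this is
  the density which that forces on \<open>X\<close>, with Jacobian 1/x.\<close>

definition lognormal_density :: "real \<Rightarrow> real \<Rightarrow> real \<Rightarrow> real" where
  "lognormal_density \<mu> \<sigma> x = (if 0 < x then normal_density \<mu> \<sigma> (ln x) / x else 0)"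

lemma borel_measurable_lognormal_density [measurable]: "lognormal_density \<mu> \<sigma> \<in> borel_measurable borel"
  unfolding lognormal_density_def[abs_def] by measurable

text \<open>Substitute x = exp u; the Jacobian cancels the factor 1/x. The test function
  \<open>h\<close> is an indicator when the law is identified and a logarithm when the entropy is
  computed.\<close>

lemma has_bochner_integral_lognormal_density:
  fixes h :: "real \<Rightarrow> real"
  assumes [measurable]: "h \<in> borel_measurable borel"
  shows "has_bochner_integral lborel (\<lambda>x. lognormal_density \<mu> \<sigma> x * h x) b \<longleftrightarrow>
    has_bochner_integral lborel (\<lambda>u. normal_density \<mu> \<sigma> u * h (exp u)) b"
proof -
  have image: "(range exp :: real set) = {0<..}"
    by (auto simp: image_iff) (metis exp_ln)
  have "has_bochner_integral lborel
      (\<lambda>u. indicator UNIV u * (\<bar>exp u\<bar> * (lognormal_density \<mu> \<sigma> (exp u) * h (exp u)))) b \<longleftrightarrow>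
      has_bochner_integral lborel (\<lambda>x. indicator (range exp) x * (lognormal_density \<mu> \<sigma> x * h x)) b"
    by (rule has_bochner_integral_substitution) (auto simp: image inj_on_def)
  moreover have "indicator (range exp) x * (lognormal_density \<mu> \<sigma> x * h x) = lognormal_density \<mu> \<sigma> x * h x" for x
    by (auto simp: image lognormal_density_def)
  moreover have "indicator UNIV u * (\<bar>exp u\<bar> * (lognormal_density \<mu> \<sigma> (exp u) * h (exp u))) =
      normal_density \<mu> \<sigma> u * h (exp u)" for u
    by (simp add: lognormal_density_def)
  ultimately show ?thesis
    by (simp only:)
qed

text \<open>Both measures are compared through integrals of indicators. Almost sure positivity
  enters when \<open>exp (ln (X \<omega>))\<close> is replaced by \<open>X \<omega>\<close>.\<close>

lemma distributed_lognormal_density: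
  assumes M: "prob_space M" and X: "lognormal_distributed M X \<mu> \<sigma>"
  shows "distributed M lborel X (\<lambda>x. ennreal (lognormal_density \<mu> \<sigma> x))"
proof -
  interpret prob_space M by fact
  have [measurable]: "X \<in> borel_measurable M" and pos: "AE \<omega> in M. 0 < X \<omega>"
    and U: "distributed M lborel (\<lambda>\<omega>. ln (X \<omega>)) (\<lambda>x. ennreal (normal_density \<mu> \<sigma> x))"
    using X by (auto simp: lognormal_distributed_def)
  have nn: "0 \<le> lognormal_density \<mu> \<sigma> x" for x
    by (simp add: lognormal_density_def)
  have "distr M lborel X = density lborel (\<lambda>x. ennreal (lognormal_density \<mu> \<sigma> x))"
  proof (rule measure_eqI)
    fix A assume "A \<in> sets (distr M lborel X)"
    then have [measurable]: "A \<in> sets borel" by simp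
    let ?h = "indicator A :: real \<Rightarrow> real"
    have bnd: "integrable M (\<lambda>\<omega>. ?h (exp (ln (X \<omega>))))"
      by (rule integrable_const_bound[where B = 1]) (auto simp: indicator_def)
    have "has_bochner_integral lborel (\<lambda>u. normal_density \<mu> \<sigma> u * ?h (exp u)) (\<integral>\<omega>. ?h (exp (ln (X \<omega>))) \<partial>M)"
      using bnd distributed_integrable[OF U, where g = "\<lambda>u. ?h (exp u)"]
        distributed_integral[OF U, where g = "\<lambda>u. ?h (exp u)"]
      by (simp add: has_bochner_integral_iff)
    moreover have "(\<integral>\<omega>. ?h (exp (ln (X \<omega>))) \<partial>M) = (\<integral>\<omega>. ?h (X \<omega>) \<partial>M)"
      using pos by (intro integral_cong_AE) auto
    ultimately have I: "has_bochner_integral lborel (\<lambda>x. lognormal_density \<mu> \<sigma> x * ?h x) (\<integral>\<omega>. ?h (X \<omega>) \<partial>M)"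
      by (subst has_bochner_integral_lognormal_density) auto
    have "emeasure (density lborel (\<lambda>x. ennreal (lognormal_density \<mu> \<sigma> x))) A =
        (\<integral>\<^sup>+x. ennreal (lognormal_density \<mu> \<sigma> x * ?h x) \<partial>lborel)"
      by (subst emeasure_density) (auto intro!: nn_integral_cong simp: indicator_def)
    also have "\<dots> = ennreal (\<integral>\<omega>. ?h (X \<omega>) \<partial>M)"
      using I nn by (subst nn_integral_eq_integral) (auto simp: has_bochner_integral_iff)
    also have "\<dots> = (\<integral>\<^sup>+\<omega>. ennreal (?h (X \<omega>)) \<partial>M)"
      by (subst nn_integral_eq_integral)
        (auto intro!: integrable_const_bound[where B = 1] simp: indicator_def)
    also have "\<dots> = (\<integral>\<^sup>+\<omega>. indicator (X -` A \<inter> space M) \<omega> \<partial>M)"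
      by (intro nn_integral_cong) (auto simp: indicator_def)
    also have "\<dots> = emeasure (distr M lborel X) A"
      by (subst emeasure_distr) auto
    finally show "emeasure (distr M lborel X) A =
      emeasure (density lborel (\<lambda>x. ennreal (lognormal_density \<mu> \<sigma> x))) A" ..
  qed simp
  then show ?thesis
    by (simp add: distributed_def)
qed

text \<open>The logarithm of the density is a constant minus a quadratic, so the total mass and the
  variance determine the integral. The variance contributes 1/2, which becomes the
  \<open>exp 1\<close> under the root.\<close>

lemma has_bochner_integral_normal_entropy:
  assumes \<sigma>: "0 < \<sigma>"
  shows "has_bochner_integral lborel (\<lambda>u. normal_density \<mu> \<sigma> u * ln (normal_density \<mu> \<sigma> u))
    (- ln (\<sigma> * sqrt (2 * pi * exp 1)))"
proof -
  have "has_bochner_integral lborel (\<lambda>u. normal_density \<mu> \<sigma> u) 1"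
    using \<sigma> by (simp add: has_bochner_integral_iff)
  moreover have "has_bochner_integral lborel (\<lambda>u. normal_density \<mu> \<sigma> u * (u - \<mu>)\<^sup>2) (\<sigma>\<^sup>2)"
    using normal_moment_even[OF \<sigma>, of \<mu> 1] \<sigma> by (simp add: field_simps numeral_2_eq_2[symmetric])
  ultimately have "has_bochner_integral lborel
      (\<lambda>u. normal_density \<mu> \<sigma> u * (- ln (\<sigma> * sqrt (2 * pi))) - normal_density \<mu> \<sigma> u * (u - \<mu>)\<^sup>2 / (2 * \<sigma>\<^sup>2))
      (1 * (- ln (\<sigma> * sqrt (2 * pi))) - \<sigma>\<^sup>2 / (2 * \<sigma>\<^sup>2))"
    by (intro has_bochner_integral_diff has_bochner_integral_mult_left has_bochner_integral_divide_zero)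
  moreover have "normal_density \<mu> \<sigma> u * (- ln (\<sigma> * sqrt (2 * pi))) - normal_density \<mu> \<sigma> u * (u - \<mu>)\<^sup>2 / (2 * \<sigma>\<^sup>2)
    = normal_density \<mu> \<sigma> u * ln (normal_density \<mu> \<sigma> u)" for u
  proof -
    have "normal_density \<mu> \<sigma> u = exp (- ln (\<sigma> * sqrt (2 * pi)) - (u - \<mu>)\<^sup>2 / (2 * \<sigma>\<^sup>2))"
    proof -
      have "exp (- ln (\<sigma> * sqrt (2 * pi))) = 1 / (\<sigma> * sqrt (2 * pi))"
        using \<sigma> by (simp add: exp_minus inverse_eq_divide)
      then show ?thesis
        using \<sigma> by (simp only: diff_conv_add_uminus exp_add) (simp add: normal_density_def real_sqrt_mult)
    qed
    then show ?thesis
      by (simp add: algebra_simps)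
  qed
  moreover have "1 * (- ln (\<sigma> * sqrt (2 * pi))) - \<sigma>\<^sup>2 / (2 * \<sigma>\<^sup>2) = - ln (\<sigma> * sqrt (2 * pi * exp 1))"
    using \<sigma> by (simp add: ln_mult real_sqrt_mult ln_sqrt)
  ultimately show ?thesis
    by (simp only:)
qed

text \<open>For x > 0, x times the lognormal density is the normal density at \<open>ln x\<close>,
  so the expectation is minus the differential entropy of \<open>ln X\<close>.\<close>

lemma fp_entropy_lognormal:
  assumes M: "prob_space M" and X: "lognormal_distributed M X \<mu> \<sigma>" and \<sigma>: "0 < \<sigma>"
  shows "fp_entropy_exists M X \<and> fp_entropy p M X = real p - 1/2 + log 2 (\<sigma> * sqrt (2 * pi * exp 1))"
proof (rule fp_entropyI[OF M distributed_lognormal_density[OF M X]])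
  show "has_bochner_integral lborel
      (\<lambda>x. lognormal_density \<mu> \<sigma> x * ln (\<bar>x\<bar> * lognormal_density \<mu> \<sigma> x)) (- ln (\<sigma> * sqrt (2 * pi * exp 1)))"
    using has_bochner_integral_normal_entropy[OF \<sigma>]
    by (subst has_bochner_integral_lognormal_density) (simp_all add: lognormal_density_def)
qed (auto simp: lognormal_density_def log_def)

text \<open>If T has this law, then T^2 / (\<nu> + T^2) is Beta distributed with parameters 1/2 and
  \<nu>/2. The substitution \<open>g\<close> is this map on the positive half line.\<close>

lemma has_bochner_integral_student_t_moment:
  assumes \<nu>: "0 < \<nu>" and t: "\<bar>t\<bar> < 1"
  shows "has_bochner_integral lborel
    (\<lambda>x. student_t_density \<nu> x * (\<bar>x\<bar> * student_t_density \<nu> x) powr t)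
    (Beta (1 / 2) (\<nu> / 2) powr (- 1 - t) * Beta (1 / 2 + 1 / 2 * t) (\<nu> / 2 + \<nu> / 2 * t))"
proof -
  define B where "B = Beta (1 / 2) (\<nu> / 2)"
  define C where "C = 1 / (sqrt \<nu> * B)"
  define a where "a = 1 / 2 + 1 / 2 * t"
  define b where "b = \<nu> / 2 + \<nu> / 2 * t"
  define z where "z x = 1 + x\<^sup>2 / \<nu>" for x
  define g where "g x = 1 - 1 / z x" for x
  define g' where "g' x = 2 * x / (\<nu> * (z x)\<^sup>2)" for x
  have B: "0 < B"
    using \<nu> by (simp add: B_def Beta_pos_real)
  have C: "0 < C"
    using B \<nu> by (simp add: C_def)
  have z: "0 < z x" for x
    using \<nu> by (simp add: z_def add_pos_nonneg)
  have t1: "0 < 1 + t" using t by simp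
  have ab: "0 < a" "0 < b"
    using t1 mult_pos_pos[OF \<nu> t1] by (simp_all add: a_def b_def field_simps)
  have f_eq: "student_t_density \<nu> x = C * z x powr (- (\<nu> + 1) / 2)" for x
  proof -
    have "C = Gamma ((\<nu> + 1) / 2) / (sqrt (\<nu> * pi) * Gamma (\<nu> / 2))"
      by (simp add: C_def B_def Beta_def Gamma_one_half_real real_sqrt_mult add_divide_distrib add.commute mult_ac)
    then show ?thesis
      by (simp add: student_t_density_def z_def)
  qed
  have image: "g ` {0<..} = {0<..<1}"
  proof (intro set_eqI iffI)
    fix y assume "y \<in> g ` {0<..}"
    then obtain x where "0 < x" "y = g x" by auto
    moreover from this have "1 < z x"
      using \<nu> by (simp add: z_def)
    ultimately show "y \<in> {0<..<1}"
      by (simp add: g_def)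
  next
    fix y :: real assume y: "y \<in> {0<..<1}"
    then have "z (sqrt (\<nu> * y / (1 - y))) = 1 / (1 - y)"
      using \<nu> by (simp add: z_def field_simps)
    then have "y = g (sqrt (\<nu> * y / (1 - y)))"
      by (simp add: g_def)
    moreover have "0 < sqrt (\<nu> * y / (1 - y))"
      using y \<nu> by simp
    ultimately show "y \<in> g ` {0<..}" by blast
  qed
  have inj: "inj_on g {0<..}"
  proof (rule inj_onI)
    fix x y assume xy: "x \<in> {0<..}" "y \<in> {0<..}" "g x = g y"
    then have "z x = z y"
      using z[of x] z[of y] by (simp add: g_def)
    then show "x = y"
      using xy \<nu> by (simp add: z_def power2_eq_iff)
  qed
  have [measurable]: "g \<in> borel_measurable borel" "g' \<in> borel_measurable borel"
    unfolding g_def g'_def z_def by measurable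
  have der: "(g has_real_derivative g' x) (at x)" for x
  proof -
    have "(z has_real_derivative 2 * x / \<nu>) (at x)"
      unfolding z_def using \<nu> by (auto intro!: derivative_eq_intros)
    then show ?thesis
      unfolding g_def g'_def using z[of x] \<nu>
      by (auto intro!: derivative_eq_intros simp: power2_eq_square field_simps)
  qed
  have "has_bochner_integral lborel
      (\<lambda>x. indicator {0<..} x * (\<bar>g' x\<bar> * (g x powr (a - 1) * (1 - g x) powr (b - 1)))) (Beta a b)"
    using has_bochner_integral_Beta[OF ab] inj der
    by (subst has_bochner_integral_substitution[where g = g and f = "\<lambda>y. y powr (a - 1) * (1 - y) powr (b - 1)"])
      (auto simp: image)
  \<comment> \<open>The factor 1/2 yields the moment over one half line; evenness doubles it at the
    end.\<close>
  then have "has_bochner_integral lborel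
      (\<lambda>x. B powr (- 1 - t) / 2 * (indicator {0<..} x * (\<bar>g' x\<bar> * (g x powr (a - 1) * (1 - g x) powr (b - 1)))))
      (B powr (- 1 - t) / 2 * Beta a b)"
    by (intro has_bochner_integral_mult_right)
  moreover have "B powr (- 1 - t) / 2 * (indicator {0<..} x * (\<bar>g' x\<bar> * (g x powr (a - 1) * (1 - g x) powr (b - 1))))
    = indicator {0<..} x * (student_t_density \<nu> x * (\<bar>x\<bar> * student_t_density \<nu> x) powr t)" for x
  proof (cases "0 < x")
    case True
    \<comment> \<open>Every factor is written as \<open>exp\<close> of a linear combination of
      \<open>ln x\<close>, \<open>ln \<nu>\<close>, \<open>ln (z x)\<close> and \<open>ln B\<close>,
      so that comparing the integrands becomes an identity between exponents.\<close>
    have "g x = x\<^sup>2 / (\<nu> * z x)"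
      using z[of x] \<nu> by (simp add: g_def field_simps) (simp add: z_def field_simps)
    then have "g x = exp (2 * ln x - ln \<nu> - ln (z x))"
      using True z[of x] \<nu> by (simp add: exp_diff power2_eq_square exp_double)
    then have g_powr: "g x powr (a - 1) = exp ((a - 1) * (2 * ln x - ln \<nu> - ln (z x)))"
      by (simp add: powr_def)
    have "1 - g x = exp (- ln (z x))"
      using z[of x] by (simp add: g_def exp_minus inverse_eq_divide)
    then have h_powr: "(1 - g x) powr (b - 1) = exp ((b - 1) * (- ln (z x)))"
      by (simp add: powr_def)
    have g'_abs: "\<bar>g' x\<bar> = 2 * exp (ln x - ln \<nu> - 2 * ln (z x))"
      using True z[of x] \<nu> by (simp add: g'_def exp_diff exp_double)
    have B_powr: "B powr (- 1 - t) = exp ((- 1 - t) * ln B)"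
      using B by (simp add: powr_def)
    have "B powr (- 1 - t) / 2 * (\<bar>g' x\<bar> * (g x powr (a - 1) * (1 - g x) powr (b - 1))) =
      exp ((- 1 - t) * ln B + (ln x - ln \<nu> - 2 * ln (z x)) + (a - 1) * (2 * ln x - ln \<nu> - ln (z x)) + (b - 1) * (- ln (z x)))"
      by (simp only: g_powr h_powr g'_abs B_powr exp_add)
    moreover have "student_t_density \<nu> x = exp (- ln \<nu> / 2 - ln B - (\<nu> + 1) / 2 * ln (z x))"
    proof -
      have "ln C = - ln \<nu> / 2 - ln B"
        using B \<nu> by (simp add: C_def ln_div ln_mult ln_sqrt)
      then have "C = exp (- ln \<nu> / 2 - ln B)"
        using C by (metis exp_ln)
      then show ?thesis
        using z[of x] by (simp only: f_eq diff_conv_add_uminus exp_add) (simp add: powr_def algebra_simps)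
    qed
    moreover from this have "\<bar>x\<bar> * student_t_density \<nu> x = exp (ln x + (- ln \<nu> / 2 - ln B - (\<nu> + 1) / 2 * ln (z x)))"
      using True by (subst exp_add) simp
    moreover have "(- 1 - t) * ln B + (ln x - ln \<nu> - 2 * ln (z x)) + (a - 1) * (2 * ln x - ln \<nu> - ln (z x)) + (b - 1) * (- ln (z x))
      = (- ln \<nu> / 2 - ln B - (\<nu> + 1) / 2 * ln (z x)) + t * (ln x + (- ln \<nu> / 2 - ln B - (\<nu> + 1) / 2 * ln (z x)))"
      by (simp add: a_def b_def field_simps)
    ultimately show ?thesis
      using True by (simp add: powr_def[of "exp _"] flip: exp_add)
  qed auto
  ultimately have "has_bochner_integral lborel
      (\<lambda>x. indicator {0<..} x * (student_t_density \<nu> x * (\<bar>x\<bar> * student_t_density \<nu> x) powr t))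
      (B powr (- 1 - t) / 2 * Beta a b)"
    by (simp only:)
  from has_bochner_integral_even_function'[OF this] show ?thesis
    by (simp add: student_t_density_def B_def a_def b_def)
qed

lemma fp_entropy_student_t:
  assumes M: "prob_space M" and X: "student_t_distributed M X \<nu> s" and pos: "0 < \<nu>" "0 < s"
  shows "fp_entropy_exists M X \<and> fp_entropy p M X = real p - 1/2 + log 2 (Beta (\<nu> / 2) (1 / 2))
    + ((\<nu> + 1) / 2 * Digamma ((\<nu> + 1) / 2) - \<nu> / 2 * Digamma (\<nu> / 2) - 1 / 2 * Digamma (1 / 2)) / ln 2"
proof -
  interpret prob_space M by fact
  let ?f = "student_t_density \<nu>"
  define B where "B = Beta (1 / 2) (\<nu> / 2)"
  have B: "0 < B"
    using pos by (simp add: B_def Beta_pos_real)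
  have [measurable]: "?f \<in> borel_measurable borel"
    unfolding student_t_density_def[abs_def] by measurable
  have [measurable]: "X \<in> borel_measurable M"
    and X': "distr M borel X = distr (density lborel (\<lambda>t. ennreal (?f t))) borel (\<lambda>t. s * t)"
    using X by (auto simp: student_t_distributed_def)
  have nn: "0 \<le> ?f x" for x
    using pos by (simp add: student_t_density_def)
  \<comment> \<open>The law is given as an image under scaling, so the density of
    \<open>X / s\<close> is found first and then rescaled.\<close>
  have "distr M lborel (\<lambda>\<omega>. X \<omega> / s) = distr (distr M borel X) lborel (\<lambda>x. x / s)"
    by (subst distr_distr) (auto simp: comp_def)
  also have "\<dots> = distr (density lborel (\<lambda>t. ennreal (?f t))) lborel (\<lambda>t. t)"
    unfolding X' using pos by (subst distr_distr) (auto simp: comp_def)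
  also have "\<dots> = density lborel (\<lambda>t. ennreal (?f t))"
    by (rule distr_id2) simp
  finally have T: "distributed M lborel (\<lambda>\<omega>. X \<omega> / s) (\<lambda>t. ennreal (?f t))"
    by (simp add: distributed_def)
  have "distributed M lborel (\<lambda>\<omega>. 0 + s * (X \<omega> / s)) (\<lambda>x. ennreal (?f ((x - 0) / s)) / ennreal \<bar>s\<bar>)"
    using pos by (intro distributed_affine[OF T]) auto
  then have X: "distributed M lborel X (\<lambda>x. ennreal (?f (x / s) / s))"
    using pos nn by (simp add: divide_ennreal)
  have "((\<lambda>t. B powr (- 1 - t) * Beta (1 / 2 + 1 / 2 * t) (\<nu> / 2 + \<nu> / 2 * t)) has_real_derivative
      - ln B + (1 / 2 * Digamma (1 / 2) + \<nu> / 2 * Digamma (\<nu> / 2) - (1 / 2 + \<nu> / 2) * Digamma (1 / 2 + \<nu> / 2))) (at 0)"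
    using has_real_derivative_normalized_Beta[of "1 / 2" "\<nu> / 2" "1 / 2" "\<nu> / 2"] pos by (simp add: B_def)
  from has_bochner_integral_ln_moment[OF _ _ nn _ zero_less_one has_bochner_integral_student_t_moment[OF pos(1)] this[unfolded B_def]]
  have I: "has_bochner_integral lborel (\<lambda>x. ?f x * ln (\<bar>x\<bar> * ?f x))
    (- ln B + (1 / 2 * Digamma (1 / 2) + \<nu> / 2 * Digamma (\<nu> / 2) - (1 / 2 + \<nu> / 2) * Digamma (1 / 2 + \<nu> / 2)))"
    using nn by (simp add: B_def)
  show ?thesis
  proof (rule fp_entropy_scaleI[OF M X pos(2) nn _ I])
    have "Beta (\<nu> / 2) (1 / 2) = B"
      by (simp add: B_def Beta_commute)
    moreover have "(\<nu> + 1) / 2 = 1 / 2 + \<nu> / 2"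
      by simp
    ultimately show "real p - 1/2 + log 2 (Beta (\<nu> / 2) (1 / 2))
      + ((\<nu> + 1) / 2 * Digamma ((\<nu> + 1) / 2) - \<nu> / 2 * Digamma (\<nu> / 2) - 1 / 2 * Digamma (1 / 2)) / ln 2 =
      real p - 1 / 2 - (- ln B + (1 / 2 * Digamma (1 / 2) + \<nu> / 2 * Digamma (\<nu> / 2)
        - (1 / 2 + \<nu> / 2) * Digamma (1 / 2 + \<nu> / 2))) / ln 2"
      by (simp only: log_def) (simp add: diff_divide_distrib add_divide_distrib)
  qed simp
qed


section \<open>The logistic distribution\<close>

text \<open>Differentiate the integral of x^t exp(-k x) at t = 0; the derivative of Gamma at 1 is
  minus the Euler-Mascheroni constant.\<close>

lemma has_bochner_integral_exp_ln:
  fixes k :: real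
  assumes k: "0 < k"
  shows "has_bochner_integral lborel (\<lambda>x. indicator {0<..} x * exp (- k * x) * ln \<bar>x\<bar>) ((- euler_mascheroni - ln k) / k)"
proof (rule has_bochner_integral_ln_moment[OF _ _ _ _ zero_less_one])
  fix t :: real assume t: "\<bar>t\<bar> < 1"
  have "has_bochner_integral lborel
      (\<lambda>x. indicator {0<..} x * (x powr (1 + t - 1) * exp (- k * x powr 1)))
      (Gamma ((1 + t) / 1) * k powr (- ((1 + t) / 1)) / 1)"
    using t k by (intro has_bochner_integral_generalized_Gamma) auto
  moreover have "indicator {0<..} x * (x powr (1 + t - 1) * exp (- k * x powr 1)) =
      indicator {0<..} x * exp (- k * x) * \<bar>x\<bar> powr t" for x
    by (auto simp: indicator_def)
  moreover have "Gamma ((1 + t) / 1) * k powr (- ((1 + t) / 1)) / 1 = Gamma (1 + t) * k powr (- (1 + t))"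
    by simp
  ultimately show "has_bochner_integral lborel (\<lambda>x. indicator {0<..} x * exp (- k * x) * \<bar>x\<bar> powr t)
      (Gamma (1 + t) * k powr (- (1 + t)))"
    by (simp only:)
next
  have "(1::real) \<notin> \<int>\<^sub>\<le>\<^sub>0"
    by (meson nonpos_Ints_nonpos not_le zero_less_one)
  then show "((\<lambda>t. Gamma (1 + t) * k powr (- (1 + t))) has_real_derivative
      (- euler_mascheroni - ln k) / k) (at 0)"
    using k by (auto intro!: derivative_eq_intros simp: powr_minus field_simps)
qed auto

text \<open>
  Ending the alternating series of \<open>y / (1 + y)\<^sup>2\<close> with half of its next term keeps the truncations
  below \<open>3 * y\<close> uniformly in \<open>m\<close>. The plain partial sums at \<open>y = exp (- x)\<close> have no integrable bound
  uniform in \<open>m\<close>, and their integrals against \<open>ln x\<close> diverge.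
\<close>

definition alternating_trunc :: "nat \<Rightarrow> real \<Rightarrow> real" where
  "alternating_trunc m y = (\<Sum>j<m. real (2 * j + 1) * y ^ (2 * j + 1) - real (2 * j + 2) * y ^ (2 * j + 2))
     + real (2 * m + 1) / 2 * y ^ (2 * m + 1)"

text \<open>Multiplication by \<open>(1 + y)\<^sup>2\<close> telescopes the sum. In what is left,
  the half term turns the coefficient of 2m+1 into (1 - y^2)/2, which vanishes at y = 1, just where
  the power y^(2m+1) fails to be small.\<close>

lemma alternating_trunc_remainder:
  fixes y :: real
  assumes "0 < y"
  shows "y / (1 + y)\<^sup>2 - alternating_trunc m y =
    y ^ (2 * m + 1) * (real (2 * m + 1) / 2 * (1 - y\<^sup>2) - y) / (1 + y)\<^sup>2"
proof -
  have y: "1 + y \<noteq> 0"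
    using assms by simp
  have "(\<Sum>j<m. real (2 * j + 1) * y ^ (2 * j + 1) - real (2 * j + 2) * y ^ (2 * j + 2)) * (1 + y)\<^sup>2 =
    y - y ^ (2 * m + 1) * (real (2 * m + 1) + real (2 * m) * y)"
    by (induction m) (simp_all add: algebra_simps power2_eq_square)
  then have "alternating_trunc m y * (1 + y)\<^sup>2 =
    y - y ^ (2 * m + 1) * (real (2 * m + 1) + real (2 * m) * y) + real (2 * m + 1) / 2 * y ^ (2 * m + 1) * (1 + y)\<^sup>2"
    by (simp add: alternating_trunc_def algebra_simps)
  then have "y - alternating_trunc m y * (1 + y)\<^sup>2 =
    y ^ (2 * m + 1) * (real (2 * m + 1) / 2 * (1 - y\<^sup>2) - y)"
    by (simp add: field_simps power2_eq_square)
  moreover have "y / (1 + y)\<^sup>2 - alternating_trunc m y = (y - alternating_trunc m y * (1 + y)\<^sup>2) / (1 + y)\<^sup>2"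
    using y by (simp add: diff_divide_distrib)
  ultimately show ?thesis
    by (simp only:)
qed

text \<open>The critical product (2m+1) y^(2m) (1 - y) is at most 1, because (2m+1) y^(2m) is below
  the geometric sum 1 + ... + y^(2m). This bounds the remainder by 2y, and y/(1+y)^2 adds at most
  another y.\<close>

lemma abs_alternating_trunc_le:
  fixes y :: real
  assumes y: "0 < y" "y < 1"
  shows "\<bar>alternating_trunc m y\<bar> \<le> 3 * y"
proof -
  define n where "n = 2 * m"
  have "real (Suc n) * y ^ n * (1 - y) \<le> (\<Sum>i<Suc n. y ^ i) * (1 - y)"
  proof (rule mult_right_mono)
    have "(\<Sum>i<Suc n. y ^ n) \<le> (\<Sum>i<Suc n. y ^ i)"
      using y by (intro sum_mono power_decreasing) auto
    then show "real (Suc n) * y ^ n \<le> (\<Sum>i<Suc n. y ^ i)" by simp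
  qed (use y in simp)
  also have "\<dots> = 1 - y ^ Suc n"
    using one_diff_power_eq[of y "Suc n"] by (simp add: mult.commute)
  also have "\<dots> \<le> 1"
    using y by simp
  finally have "real (Suc n) * y ^ n * (1 - y) * ((1 + y) / 2 * y) \<le> 1 * (1 * y)"
    using y by (intro mult_mono) auto
  moreover have "N * y ^ n * (1 - y) * ((1 + y) / 2 * y) = y ^ Suc n * (N / 2 * (1 - y\<^sup>2))" for N
    by (simp add: field_simps power2_eq_square)
  ultimately have 1: "y ^ Suc n * (real (Suc n) / 2 * (1 - y\<^sup>2)) \<le> y"
    by (simp only: mult_1)
  have 2: "y ^ Suc n * y \<le> y"
    using y power_le_one[of y "Suc n"] by (simp add: mult_le_cancel_right1 del: power_Suc)
  have 3: "0 \<le> y ^ Suc n * (real (Suc n) / 2 * (1 - y\<^sup>2))" "0 \<le> y ^ Suc n * y"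
    using y by (auto simp: power_le_one)
  have "\<bar>y ^ Suc n * (real (Suc n) / 2 * (1 - y\<^sup>2) - y)\<bar> \<le> 2 * y"
    using 1 2 3 unfolding right_diff_distrib by linarith
  moreover have "1 \<le> (1 + y)\<^sup>2"
    using y by simp
  ultimately have "\<bar>y ^ Suc n * (real (Suc n) / 2 * (1 - y\<^sup>2) - y)\<bar> / (1 + y)\<^sup>2 \<le> 2 * y / 1"
    using y by (intro frac_le) auto
  then have "\<bar>y / (1 + y)\<^sup>2 - alternating_trunc m y\<bar> \<le> 2 * y"
    using alternating_trunc_remainder[OF y(1), of m] by (simp add: n_def abs_divide)
  moreover have "y / (1 + y)\<^sup>2 \<le> y / 1"
    using y \<open>1 \<le> (1 + y)\<^sup>2\<close> by (intro frac_le) auto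
  moreover have "0 \<le> y / (1 + y)\<^sup>2"
    using y by simp
  ultimately show ?thesis
    by linarith
qed

lemma alternating_trunc_tendsto:
  fixes y :: real
  assumes y: "0 < y" "y < 1"
  shows "(\<lambda>m. alternating_trunc m y) \<longlonglongrightarrow> y / (1 + y)\<^sup>2"
proof -
  have sub: "filterlim (\<lambda>m::nat. 2 * m + 1) at_top at_top"
    by real_asymp
  have "(\<lambda>n. real n * y ^ n) \<longlonglongrightarrow> 0"
    using y by (intro powser_times_n_limit_0) auto
  from filterlim_compose[OF this sub]
  have 1: "(\<lambda>m. real (2 * m + 1) * y ^ (2 * m + 1)) \<longlonglongrightarrow> 0" .
  have "(\<lambda>n. y ^ n) \<longlonglongrightarrow> 0"
    using y by (intro LIMSEQ_realpow_zero) auto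
  from filterlim_compose[OF this sub]
  have 2: "(\<lambda>m. y ^ (2 * m + 1)) \<longlonglongrightarrow> 0" .
  have "(\<lambda>m. y / (1 + y)\<^sup>2 - ((real (2 * m + 1) * y ^ (2 * m + 1)) * ((1 - y\<^sup>2) / 2) - y ^ (2 * m + 1) * y) / (1 + y)\<^sup>2)
      \<longlonglongrightarrow> y / (1 + y)\<^sup>2 - (0 * ((1 - y\<^sup>2) / 2) - 0 * y) / (1 + y)\<^sup>2"
    using y by (intro tendsto_intros 1 2) auto
  moreover have "y / (1 + y)\<^sup>2 - ((real (2 * m + 1) * y ^ (2 * m + 1)) * ((1 - y\<^sup>2) / 2) - y ^ (2 * m + 1) * y) / (1 + y)\<^sup>2
      = alternating_trunc m y" for m
  proof -
    have "Y * (N / 2 * (1 - y\<^sup>2) - y) = (N * Y) * ((1 - y\<^sup>2) / 2) - Y * y" for N Y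
      by (simp add: field_simps)
    from alternating_trunc_remainder[OF y(1), of m, unfolded this] show ?thesis
      by linarith
  qed
  ultimately show ?thesis
    by simp
qed

text \<open>The coefficient n cancels the 1/n in the integral of exp(-n x) ln x, so each term gives
  \<open>- euler_mascheroni - ln n\<close>. The constant cancels within the pairs and survives only
  in the half term.\<close>

lemma has_bochner_integral_alternating_trunc_ln:
  "has_bochner_integral lborel (\<lambda>x. indicator {0<..} x * alternating_trunc m (exp (- x)) * ln \<bar>x\<bar>)
    ((\<Sum>j<m. ln (real (2 * j + 2)) - ln (real (2 * j + 1))) - ln (real (2 * m + 1)) / 2 - euler_mascheroni / 2)"
proof -
  have *: "has_bochner_integral lborel (\<lambda>x. real (Suc n) * (indicator {0<..} x * exp (- x) ^ Suc n * ln \<bar>x\<bar>))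
      (- euler_mascheroni - ln (real (Suc n)))" for n
  proof -
    have "has_bochner_integral lborel (\<lambda>x. real (Suc n) * (indicator {0<..} x * exp (- real (Suc n) * x) * ln \<bar>x\<bar>))
        (real (Suc n) * ((- euler_mascheroni - ln (real (Suc n))) / real (Suc n)))"
      by (intro has_bochner_integral_mult_right has_bochner_integral_exp_ln) simp
    moreover have "exp (- real (Suc n) * x) = exp (- x) ^ Suc n" for x
      using exp_of_nat_mult[of "Suc n" "- x"] by (simp only: mult_minus_left mult_minus_right)
    moreover have "real (Suc n) * ((- euler_mascheroni - ln (real (Suc n))) / real (Suc n)) =
        - euler_mascheroni - ln (real (Suc n))"
      by (rule nonzero_mult_div_cancel_left[THEN trans[OF times_divide_eq_right]]) simp
    ultimately show ?thesis
      by (simp only:)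
  qed
  have "has_bochner_integral lborel
      (\<lambda>x. (\<Sum>j<m. real (Suc (2 * j)) * (indicator {0<..} x * exp (- x) ^ Suc (2 * j) * ln \<bar>x\<bar>)
          - real (Suc (2 * j + 1)) * (indicator {0<..} x * exp (- x) ^ Suc (2 * j + 1) * ln \<bar>x\<bar>))
        + real (Suc (2 * m)) * (indicator {0<..} x * exp (- x) ^ Suc (2 * m) * ln \<bar>x\<bar>) / 2)
      ((\<Sum>j<m. (- euler_mascheroni - ln (real (Suc (2 * j)))) - (- euler_mascheroni - ln (real (Suc (2 * j + 1)))))
        + (- euler_mascheroni - ln (real (Suc (2 * m)))) / 2)"
    by (intro has_bochner_integral_add has_bochner_integral_sum has_bochner_integral_diff
        has_bochner_integral_divide_zero *)
  moreover have "(\<Sum>j<m. real (Suc (2 * j)) * (indicator {0<..} x * exp (- x) ^ Suc (2 * j) * ln \<bar>x\<bar>)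
          - real (Suc (2 * j + 1)) * (indicator {0<..} x * exp (- x) ^ Suc (2 * j + 1) * ln \<bar>x\<bar>))
        + real (Suc (2 * m)) * (indicator {0<..} x * exp (- x) ^ Suc (2 * m) * ln \<bar>x\<bar>) / 2 =
      indicator {0<..} x * alternating_trunc m (exp (- x)) * ln \<bar>x\<bar>" for x
    by (simp only: alternating_trunc_def sum_distrib_left sum_distrib_right distrib_left distrib_right
        left_diff_distrib right_diff_distrib Suc_eq_plus1 add.assoc one_add_one) (simp add: mult_ac)
  moreover have "(\<Sum>j<m. (- euler_mascheroni - ln (real (Suc (2 * j)))) - (- euler_mascheroni - ln (real (Suc (2 * j + 1)))))
        + (- euler_mascheroni - ln (real (Suc (2 * m)))) / 2 =
      (\<Sum>j<m. ln (real (2 * j + 2)) - ln (real (2 * j + 1))) - ln (real (2 * m + 1)) / 2 - euler_mascheroni / 2"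
    by (simp add: field_simps)
  ultimately show ?thesis
    by (simp only:)
qed

text \<open>Twice the sequence is the logarithm of the Wallis partial product. The factors 2k-1 and
  2k+1 of its denominator pair up to squares except for a single 2m+1 at the end, and the half term
  supplies exactly this one.\<close>

lemma wallis_ln:
  "(\<lambda>m. (\<Sum>j<m. ln (real (2 * j + 2)) - ln (real (2 * j + 1))) - ln (real (2 * m + 1)) / 2) \<longlonglongrightarrow> ln (pi / 2) / 2"
proof -
  have "(\<Prod>k=1..m. (4 * real k ^ 2) / (4 * real k ^ 2 - 1)) =
      exp (2 * ((\<Sum>j<m. ln (real (2 * j + 2)) - ln (real (2 * j + 1))) - ln (real (2 * m + 1)) / 2))" for m
  proof (induction m)
    case (Suc m)
    have "exp (2 * ln a - ln b - ln c) = a\<^sup>2 / (b * c)" if "0 < a" "0 < b" "0 < c" for a b c :: real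
      using that by (simp add: exp_diff exp_double)
    from this[of "real (2 * m + 2)" "real (2 * m + 1)" "real (2 * Suc m + 1)"]
    have "(4 * real (Suc m) ^ 2) / (4 * real (Suc m) ^ 2 - 1) =
      exp (2 * ln (real (2 * m + 2)) - ln (real (2 * m + 1)) - ln (real (2 * Suc m + 1)))"
      by (simp add: power2_eq_square algebra_simps)
    with Suc show ?case
      by (simp add: algebra_simps del: of_nat_Suc flip: exp_add)
  qed simp
  with wallis have "(\<lambda>m. ln (exp (2 * ((\<Sum>j<m. ln (real (2 * j + 2)) - ln (real (2 * j + 1))) - ln (real (2 * m + 1)) / 2))))
      \<longlonglongrightarrow> ln (pi / 2)"
    by (intro tendsto_ln) auto
  then have "(\<lambda>m. 2 * ((\<Sum>j<m. ln (real (2 * j + 2)) - ln (real (2 * j + 1))) - ln (real (2 * m + 1)) / 2) / 2)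
      \<longlonglongrightarrow> ln (pi / 2) / 2"
    unfolding ln_exp by (intro tendsto_divide tendsto_const) auto
  then show ?thesis
    unfolding nonzero_mult_div_cancel_left[OF zero_neq_numeral[symmetric]] .
qed

text \<open>Dominated convergence along the truncations. The series needs y < 1, that is x > 0;
  evenness of the density accounts for the other half line.\<close>

lemma has_bochner_integral_logistic_ln_abs:
  "has_bochner_integral lborel (\<lambda>x. logistic_density 1 x * ln \<bar>x\<bar>) (ln (pi / 2) - euler_mascheroni)"
proof -
  let ?s = "\<lambda>m x::real. indicator {0<..} x * alternating_trunc m (exp (- x)) * ln \<bar>x\<bar>"
  let ?f = "\<lambda>x. indicator {0<..} x * (logistic_density 1 x * ln \<bar>x\<bar>)"
  \<comment> \<open>The uniform bound 3y at y = exp(-x), times |ln x|; it is integrable by the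
    exponential integral with \<open>k = 1\<close>.\<close>
  let ?w = "\<lambda>x::real. \<bar>3 * (indicator {0<..} x * exp (- 1 * x) * ln \<bar>x\<bar>)\<bar>"
  note int_s = has_bochner_integral_alternating_trunc_ln
  have [measurable]: "?f \<in> borel_measurable lborel"
    unfolding logistic_density_def by measurable
  have [measurable]: "?s m \<in> borel_measurable lborel" for m
    unfolding alternating_trunc_def by measurable
  have int_w: "integrable lborel ?w"
    using has_bochner_integral_exp_ln[of 1]
    by (intro integrable_abs integrable_mult_right) (simp add: has_bochner_integral_iff)
  have lim: "AE x in lborel. (\<lambda>m. ?s m x) \<longlonglongrightarrow> ?f x"
  proof (rule AE_I2)
    fix x :: real
    show "(\<lambda>m. ?s m x) \<longlonglongrightarrow> ?f x"
    proof (cases "0 < x")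
      case True
      then have "(\<lambda>m. alternating_trunc m (exp (- x)) * ln \<bar>x\<bar>) \<longlonglongrightarrow> exp (- x) / (1 + exp (- x))\<^sup>2 * ln \<bar>x\<bar>"
        by (intro tendsto_mult alternating_trunc_tendsto) auto
      then show ?thesis
        using True by (simp add: logistic_density_def)
    qed simp
  qed
  have bound: "AE x in lborel. norm (?s m x) \<le> ?w x" for m
  proof (rule AE_I2)
    fix x :: real
    show "norm (?s m x) \<le> ?w x"
    proof (cases "0 < x")
      case True
      then have "\<bar>alternating_trunc m (exp (- x))\<bar> * \<bar>ln x\<bar> \<le> 3 * exp (- x) * \<bar>ln x\<bar>"
        by (intro mult_right_mono abs_alternating_trunc_le) auto
      then show ?thesis
        using True by (simp add: abs_mult)
    qed simp
  qed
  have "(\<lambda>m. integral\<^sup>L lborel (?s m)) \<longlonglongrightarrow> integral\<^sup>L lborel ?f"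
    by (rule integral_dominated_convergence[OF _ _ int_w lim bound]) measurable
  moreover have "(\<lambda>m. integral\<^sup>L lborel (?s m)) \<longlonglongrightarrow> ln (pi / 2) / 2 - euler_mascheroni / 2"
    using int_s by (simp only: has_bochner_integral_iff) (intro tendsto_diff wallis_ln tendsto_const)
  ultimately have "integral\<^sup>L lborel ?f = ln (pi / 2) / 2 - euler_mascheroni / 2"
    by (rule LIMSEQ_unique)
  moreover have "integrable lborel ?f"
    by (rule integrable_dominated_convergence[OF _ _ int_w lim bound]) measurable
  ultimately have "has_bochner_integral lborel ?f (ln (pi / 2) / 2 - euler_mascheroni / 2)"
    by (simp add: has_bochner_integral_iff)
  then have "has_bochner_integral lborel (\<lambda>x. logistic_density 1 x * ln \<bar>x\<bar>)
      (2 * (ln (pi / 2) / 2 - euler_mascheroni / 2))"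
  proof (rule has_bochner_integral_even_function')
    fix x :: real
    have "exp x / (1 + exp x)\<^sup>2 = exp (- x) / (1 + exp (- x))\<^sup>2"
      by (simp add: exp_minus field_simps power2_eq_square)
    then show "logistic_density 1 (- x) * ln \<bar>- x\<bar> = logistic_density 1 x * ln \<bar>x\<bar>"
      by (simp add: logistic_density_def)
  qed
  then show ?thesis
    by simp
qed

text \<open>The distribution function satisfies F' = F (1 - F), so y = F(x) turns the integral of
  the density to the power 1 + t into a Beta integral with both arguments 1 + t.\<close>

lemma has_bochner_integral_logistic_entropy:
  "has_bochner_integral lborel (\<lambda>x. logistic_density 1 x * ln (logistic_density 1 x)) (- 2)"
proof -
  define F :: "real \<Rightarrow> real" where "F x = 1 / (1 + exp (- x))" for x
  let ?f = "logistic_density 1"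
  have nz: "1 + exp (- x) \<noteq> 0" "0 < 1 + exp (- x)" for x :: real
    by (simp_all add: add_pos_pos less_imp_neq[symmetric])
  have f_eq: "?f x = F x * (1 - F x)" for x
    using nz[of x] by (simp add: logistic_density_def F_def field_simps power2_eq_square)
  have nn: "0 \<le> ?f x" for x
    by (simp add: logistic_density_def)
  have [measurable]: "F \<in> borel_measurable borel" "?f \<in> borel_measurable borel"
    unfolding F_def logistic_density_def[abs_def] by measurable
  have image: "range F = {0<..<1}"
  proof (intro set_eqI iffI)
    fix y :: real assume y: "y \<in> {0<..<1}"
    have "F (- ln (1 / y - 1)) = y"
      using y by (simp add: F_def)
    then show "y \<in> range F" by (metis rangeI)
  qed (use nz in \<open>auto simp: F_def\<close>)
  have der: "(F has_real_derivative ?f x) (at x)" for x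
    unfolding F_def logistic_density_def using nz[of x]
    by (auto intro!: derivative_eq_intros simp: power2_eq_square field_simps)
  have inj: "inj F"
    using nz by (auto simp: inj_on_def F_def)
  \<comment> \<open>The factor \<open>Beta 1 1\<close> equals 1; it brings the moment into the form
    whose derivative is known.\<close>
  have mom: "has_bochner_integral lborel (\<lambda>x. ?f x * ?f x powr t) (Beta 1 1 powr (- 1 - t) * Beta (1 + 1 * t) (1 + 1 * t))"
    if t: "\<bar>t\<bar> < 1" for t
  proof -
    have "has_bochner_integral lborel (\<lambda>x. indicator {0<..<1} x * (x powr (1 + t - 1) * (1 - x) powr (1 + t - 1))) (Beta (1 + t) (1 + t))"
      using t by (intro has_bochner_integral_Beta) auto
    then have "has_bochner_integral lborel
        (\<lambda>x. indicator UNIV x * (\<bar>?f x\<bar> * (F x powr (1 + t - 1) * (1 - F x) powr (1 + t - 1)))) (Beta (1 + t) (1 + t))"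
      using inj der
      by (subst has_bochner_integral_substitution[where g = F and f = "\<lambda>y. y powr (1 + t - 1) * (1 - y) powr (1 + t - 1)"])
        (auto simp: image)
    moreover have "indicator UNIV x * (\<bar>?f x\<bar> * (F x powr (1 + t - 1) * (1 - F x) powr (1 + t - 1))) = ?f x * ?f x powr t" for x
    proof -
      have "F x \<in> {0<..<1}" using image by blast
      then show ?thesis
        using nn[of x] by (simp add: f_eq powr_mult)
    qed
    moreover have "Beta 1 1 = (1::real)"
      by (simp add: Beta_def Gamma_numeral)
    ultimately show ?thesis
      by simp
  qed
  have "has_bochner_integral lborel (\<lambda>x. ?f x * ln (?f x))
      (- ln (Beta 1 1) + (1 * Digamma 1 + 1 * Digamma 1 - (1 + 1) * Digamma (1 + 1)))"
    by (rule has_bochner_integral_ln_moment[OF _ _ nn nn zero_less_one mom has_real_derivative_normalized_Beta]) auto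
  moreover have "- ln (Beta 1 1) + (1 * Digamma 1 + 1 * Digamma 1 - (1 + 1) * Digamma (1 + 1)) = (- 2 :: real)"
    using Digamma_plus1[of "1::real"] by (simp add: Beta_def Gamma_numeral)
  ultimately show ?thesis
    by (simp only:)
qed

lemma fp_entropy_logistic:
  assumes M: "prob_space M" and X: "distributed M lborel X (\<lambda>x. ennreal (logistic_density s x))"
    and s: "0 < s"
  shows "fp_entropy_exists M X \<and> fp_entropy p M X = real p - 1/2 + (2 + euler_mascheroni - ln (pi / 2)) / ln 2"
proof (rule fp_entropy_scaleI[where f = "logistic_density 1", OF M _ s])
  show "distributed M lborel X (\<lambda>x. ennreal (logistic_density 1 (x / s) / s))"
    using X by (simp add: logistic_density_def mult.commute)
  have pos: "0 < logistic_density 1 x" for x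
  proof -
    have "0 < 1 + exp (- x)" by (simp add: add_pos_pos)
    then show ?thesis by (simp add: logistic_density_def)
  qed
  then show "0 \<le> logistic_density 1 x" for x
    by (simp add: less_imp_le)
  show meas [measurable]: "logistic_density 1 \<in> borel_measurable borel"
    unfolding logistic_density_def[abs_def] by measurable
  \<comment> \<open>The logarithm of the product splits only away from 0: there
    \<open>ln 0 = 0\<close> spoils the identity.\<close>
  have "AE x in lborel. logistic_density 1 x * ln \<bar>x\<bar> + logistic_density 1 x * ln (logistic_density 1 x) =
      logistic_density 1 x * ln (\<bar>x\<bar> * logistic_density 1 x)"
    using AE_lborel_singleton[of "0::real"]
    by (rule eventually_mono) (simp add: ln_mult pos algebra_simps less_imp_neq[OF pos, symmetric])
  moreover have "has_bochner_integral lborel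
      (\<lambda>x. logistic_density 1 x * ln \<bar>x\<bar> + logistic_density 1 x * ln (logistic_density 1 x))
      (ln (pi / 2) - euler_mascheroni + - 2)"
    by (intro has_bochner_integral_add has_bochner_integral_logistic_ln_abs has_bochner_integral_logistic_entropy)
  ultimately show "has_bochner_integral lborel
      (\<lambda>x. logistic_density 1 x * ln (\<bar>x\<bar> * logistic_density 1 x)) (ln (pi / 2) - euler_mascheroni + - 2)"
    by (subst has_bochner_integral_cong_AE[symmetric]) auto
qed (simp add: field_simps)


section \<open>Eigenvalues of positive definite matrices\<close>

lemma linear_coeff_eq_0_if_quadratic_nonneg:
  fixes b c :: real
  assumes "\<And>t. 0 \<le> 2 * t * b + t\<^sup>2 * c" "0 \<le> c"
  shows "b = 0"
proof -
  \<comment> \<open>Close to the minimizer \<open>- b / c\<close>, but defined also for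
    \<open>c = 0\<close>; the quadratic takes the value \<open>- (t\<^sup>2 * (c + 2))\<close>
    there.\<close>
  define t where "t = - b / (c + 1)"
  have b: "b = - (t * (c + 1))"
    using assms(2) by (simp add: t_def)
  have "0 \<le> - (t\<^sup>2 * (c + 2))"
    using assms(1)[of t] by (simp add: b algebra_simps power2_eq_square)
  then have "t = 0"
    using assms(2) by (simp add: mult_le_0_iff)
  then show ?thesis
    by (simp add: b)
qed

text \<open>Rayleigh's principle: take a maximizer \<open>v\<close> of
  \<open>f x \<bullet> x\<close> on the unit sphere of \<open>V\<close>. The form \<open>Q\<close>
  is nonnegative on \<open>V\<close> and vanishes at \<open>v\<close>, so its first-order change in
  the direction of the defect \<open>w\<close> is 0; that change is a multiple of
  \<open>w \<bullet> w\<close>.\<close>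

lemma selfadjoint_eigenvector:
  fixes f :: "'a::euclidean_space \<Rightarrow> 'a"
  assumes f: "linear f" and adj: "\<And>x y. f x \<bullet> y = x \<bullet> f y"
    and V: "subspace V" "f ` V \<subseteq> V" "V \<noteq> {0}"
  obtains v l where "v \<in> V" "norm v = 1" "f v = l *\<^sub>R v"
proof -
  interpret f: linear f by fact
  obtain x0 where x0: "x0 \<in> V" "x0 \<noteq> 0"
    using V subspace_0 by blast
  have "x0 /\<^sub>R norm x0 \<in> sphere 0 1 \<inter> V"
    using x0 V(1) by (auto simp: subspace_scale)
  then have ne: "sphere 0 1 \<inter> V \<noteq> {}" by blast
  have cpt: "compact (sphere 0 1 \<inter> V)"
    using V(1) by (intro compact_Int_closed closed_subspace) auto
  have cont: "continuous_on (sphere 0 1 \<inter> V) (\<lambda>x. f x \<bullet> x)"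
    using f by (intro continuous_intros linear_continuous_on linear_conv_bounded_linear[THEN iffD1])
  obtain v where v: "v \<in> V" "norm v = 1" and max: "\<And>x. x \<in> V \<Longrightarrow> norm x = 1 \<Longrightarrow> f x \<bullet> x \<le> f v \<bullet> v"
    using continuous_attains_sup[OF cpt ne cont] by auto
  define l where "l = f v \<bullet> v"
  define Q where "Q x = l * (x \<bullet> x) - f x \<bullet> x" for x
  have Q_nonneg: "0 \<le> Q x" if "x \<in> V" for x
  proof (cases "x = 0")
    case False
    have "f (x /\<^sub>R norm x) \<bullet> (x /\<^sub>R norm x) \<le> l"
      unfolding l_def using that False V(1) by (intro max) (auto simp: subspace_scale)
    then show ?thesis
      using False by (simp add: Q_def f.scaleR dot_square_norm power2_eq_square field_simps)
  qed (simp add: Q_def)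
  have Qv: "Q v = 0"
    using v by (simp add: Q_def l_def dot_square_norm)
  define w where "w = f v - l *\<^sub>R v"
  have w: "w \<in> V"
    unfolding w_def using V v by (intro subspace_diff subspace_scale) auto
  have "- (w \<bullet> w) = 0"
  proof (rule linear_coeff_eq_0_if_quadratic_nonneg[OF _ Q_nonneg[OF w]])
    fix t :: real
    have "Q (v + t *\<^sub>R w) = Q v + 2 * t * (l * (v \<bullet> w) - f v \<bullet> w) + t\<^sup>2 * Q w"
      using adj[of w v] by (simp add: Q_def f.add f.scaleR inner_add_left inner_add_right
          inner_commute[of w v] inner_commute[of w "f v"] algebra_simps power2_eq_square)
    also have "l * (v \<bullet> w) - f v \<bullet> w = - (w \<bullet> w)"
      by (simp add: w_def inner_diff_left algebra_simps)
    finally show "0 \<le> 2 * t * - (w \<bullet> w) + t\<^sup>2 * Q w"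
      using Q_nonneg[of "v + t *\<^sub>R w"] Qv v w V(1) by (simp add: subspace_add subspace_scale)
  qed
  then have "f v = l *\<^sub>R v"
    by (simp add: w_def)
  with v that show thesis by blast
qed

text \<open>Split off one eigenvector; its orthogonal complement within \<open>V\<close> is again
  invariant because \<open>f\<close> is selfadjoint, and has smaller dimension.\<close>

lemma selfadjoint_eigenbasis:
  fixes f :: "'a::euclidean_space \<Rightarrow> 'a"
  assumes f: "linear f" and adj: "\<And>x y. f x \<bullet> y = x \<bullet> f y"
  shows "subspace V \<Longrightarrow> f ` V \<subseteq> V \<Longrightarrow>
    \<exists>B. pairwise orthogonal B \<and> span B = V \<and> (\<forall>b\<in>B. norm b = 1 \<and> (\<exists>l. f b = l *\<^sub>R b))"
proof (induction "dim V" arbitrary: V rule: less_induct)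
  case less
  show ?case
  proof (cases "V = {0}")
    case True
    then show ?thesis by (intro exI[of _ "{}"]) simp
  next
    case False
    obtain v l where v: "v \<in> V" "norm v = 1" "f v = l *\<^sub>R v"
      using selfadjoint_eigenvector[OF f adj less.prems False] by blast
    define W where "W = V \<inter> {x. v \<bullet> x = 0}"
    have W: "subspace W"
      unfolding W_def using less.prems(1) by (intro subspace_inter subspace_hyperplane)
    have vv: "v \<bullet> v = 1"
      using v(2) by (simp add: dot_square_norm)
    have "v \<notin> W"
      by (simp add: W_def vv)
    moreover have "W \<subseteq> V"
      by (simp add: W_def)
    ultimately have "W \<subset> V"
      using v(1) by blast
    then have "dim W < dim V"
      using W less.prems(1) by (intro dim_psubset) (simp add: span_eq_iff[THEN iffD2])
    moreover have "f ` W \<subseteq> W"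
    proof
      fix y assume "y \<in> f ` W"
      then obtain x where x: "x \<in> V" "v \<bullet> x = 0" "y = f x"
        by (auto simp: W_def)
      then show "y \<in> W"
        using less.prems(2) adj[of v x] v(3) by (auto simp: W_def)
    qed
    ultimately obtain B where B: "pairwise orthogonal B" "span B = W" "\<forall>b\<in>B. norm b = 1 \<and> (\<exists>l. f b = l *\<^sub>R b)"
      using less.hyps W by blast
    have BW: "B \<subseteq> W"
      using B(2) span_superset by blast
    have "pairwise orthogonal (insert v B)"
      using B(1) BW by (auto simp: pairwise_insert orthogonal_def W_def inner_commute)
    moreover have "span (insert v B) = V"
    proof
      show "span (insert v B) \<subseteq> V"
        using BW v(1) less.prems(1) by (intro span_minimal) (auto simp: W_def)
      show "V \<subseteq> span (insert v B)"
      proof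
        fix x assume x: "x \<in> V"
        have "x - (v \<bullet> x) *\<^sub>R v \<in> W"
          using x v(1) vv less.prems(1) by (auto simp: W_def inner_diff_right subspace_diff subspace_scale)
        then show "x \<in> span (insert v B)"
          using B(2) by (auto simp: span_breakdown_eq)
      qed
    qed
    ultimately show ?thesis
      using B(3) v by (intro exI[of _ "insert v B"]) auto
  qed
qed

section \<open>Diagonalization and the characteristic polynomial\<close>

lemma matrix_mul_diag:
  fixes A :: "'a::semiring_1 ^ 'n ^ 'm"
  shows "(A ** (\<chi> i j. if i = j then d i else 0)) $ i $ j = A $ i $ j * d j"
  by (simp add: matrix_matrix_mult_def mult_delta_right)

lemma symmetric_matrix_diagonalization:
  fixes S :: "real ^ 'n ^ 'n"
  assumes S: "transpose S = S"
  obtains P :: "real ^ 'n ^ 'n" and d :: "'n \<Rightarrow> real"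
  where "orthogonal_matrix P" "S ** P = P ** (\<chi> i j. if i = j then d i else 0)"
proof -
  have lin: "linear ((*v) S)"
    by simp
  have adj: "(S *v x) \<bullet> y = x \<bullet> (S *v y)" for x y
    by (metis S dot_lmul_matrix transpose_matrix_vector)
  obtain B where B: "pairwise orthogonal B" "span B = (UNIV :: (real ^ 'n) set)"
      "\<forall>b\<in>B. norm b = 1 \<and> (\<exists>l. S *v b = l *\<^sub>R b)"
    using selfadjoint_eigenbasis[OF lin adj, of UNIV] by auto
  have indep: "independent B"
    using B(1,3) by (intro pairwise_orthogonal_independent) auto
  \<comment> \<open>The basis has as many elements as there are indices, so it can be indexed by
    \<open>'n\<close> and form the columns of \<open>P\<close>.\<close>
  then have "finite B" "card B = CARD('n)"
    using B(2) dim_eq_card[OF _ indep, of UNIV] by (auto simp: independent_imp_finite dim_UNIV)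
  then obtain e where e: "bij_betw e (UNIV :: 'n set) B"
    using finite_same_card_bij[of "UNIV :: 'n set" B] by auto
  have eB: "e i \<in> B" for i
    using e by (auto simp: bij_betw_def)
  have e_inner: "e i \<bullet> e j = (if i = j then 1 else 0)" for i j
  proof (cases "i = j")
    case True
    then show ?thesis using B(3) eB[of i] by (simp add: dot_square_norm)
  next
    case False
    then have "e i \<noteq> e j"
      using e by (auto simp: bij_betw_def inj_on_def)
    then show ?thesis
      using B(1) eB[of i] eB[of j] False by (auto simp: pairwise_def orthogonal_def)
  qed
  have "\<forall>i. \<exists>l. S *v e i = l *\<^sub>R e i"
    using B(3) eB by blast
  from choice[OF this] obtain d where d: "\<And>i. S *v e i = d i *\<^sub>R e i"
    by blast
  define P :: "real ^ 'n ^ 'n" where "P = (\<chi> i j. e j $ i)"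
  have "transpose P ** P = mat 1"
    using e_inner by (simp add: P_def matrix_matrix_mult_def transpose_def mat_def vec_eq_iff inner_vec_def)
  then have "orthogonal_matrix P"
    by (simp add: orthogonal_matrix)
  moreover have "S ** P = P ** (\<chi> i j. if i = j then d i else 0)"
  proof -
    have "(\<Sum>k\<in>UNIV. S $ i $ k * e j $ k) = d j * e j $ i" for i j
      using d[of j] by (simp add: matrix_vector_mult_def vec_eq_iff)
    then show ?thesis
      by (simp add: vec_eq_iff matrix_mul_diag) (simp add: P_def matrix_matrix_mult_def mult.commute)
  qed
  ultimately show thesis by (rule that)
qed

text \<open>Column j of \<open>P\<close> is a unit vector at which the quadratic form of
  \<open>S\<close> takes the value \<open>d j\<close>, hence positivity. The characteristic
  polynomial is the product of the linear factors with roots \<open>d i\<close>, so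
  \<open>proots\<close> returns them with multiplicity.\<close>

lemma pos_def_matrix_eigenvalues:
  fixes S :: "real ^ 'n ^ 'n"
  assumes "pos_def_matrix S"
  shows "prod_mset (eigenvalues S) = det S" and "0 < det S"
proof -
  have S: "transpose S = S" and pos: "\<And>x. x \<noteq> 0 \<Longrightarrow> 0 < x \<bullet> (S *v x)"
    using assms by (auto simp: pos_def_matrix_def)
  obtain P d where P: "orthogonal_matrix P" and SP: "S ** P = P ** (\<chi> i j. if i = j then d i else 0)"
    using symmetric_matrix_diagonalization[OF S] by blast
  let ?D = "(\<chi> i j. if i = j then d i else 0) :: real ^ 'n ^ 'n"
  have PP: "transpose P ** P = mat 1" "P ** transpose P = mat 1"
    using P by (auto simp: orthogonal_matrix_def)
  have det_P: "det P \<noteq> 0"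
    using arg_cong[OF PP(1), of det] by (auto simp: det_mul)
  have "det S * det P = det P * det ?D"
    using arg_cong[OF SP, of det] by (simp only: det_mul)
  moreover have "det ?D = (\<Prod>i\<in>UNIV. d i)"
    by (subst det_diagonal) auto
  ultimately have det_S: "det S = (\<Prod>i\<in>UNIV. d i)"
    using det_P by simp
  have d_pos: "0 < d j" for j
  proof -
    define v where "v = column j P"
    have "S *v v = d j *\<^sub>R v"
    proof -
      have "(S ** P) $ i $ j = (P ** ?D) $ i $ j" for i
        using SP by simp
      then have "(S ** P) $ i $ j = P $ i $ j * d j" for i
        by (simp only: matrix_mul_diag)
      then show ?thesis
        by (simp add: v_def column_def matrix_matrix_mult_def matrix_vector_mult_def vec_eq_iff mult.commute)
    qed
    moreover have "v \<bullet> v = 1"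
    proof -
      have "(transpose P ** P) $ j $ j = 1"
        using PP(1) by (simp add: mat_def)
      then show ?thesis
        by (simp add: v_def column_def matrix_matrix_mult_def transpose_def inner_vec_def)
    qed
    moreover from this have "v \<noteq> 0" by auto
    ultimately show ?thesis
      using pos[of v] by simp
  qed
  then show "0 < det S"
    by (simp add: det_S prod_pos)
  \<comment> \<open>Real matrices become matrices of constant polynomials. As \<open>c\<close> is
    multiplicative, \<open>c P\<close> intertwines the characteristic matrices of \<open>S\<close>
    and of the diagonal matrix, and its nonzero determinant cancels in the domain of
    polynomials.\<close>
  define c :: "real ^ 'n ^ 'n \<Rightarrow> real poly ^ 'n ^ 'n" where "c A = (\<chi> i j. [:A $ i $ j:])" for A
  have c_mult: "c (A ** B) = c A ** c B" for A B
    by (simp add: c_def matrix_matrix_mult_def vec_eq_iff mult.commute flip: sum_to_poly)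
  have det_cP: "det (c P) \<noteq> 0"
  proof
    assume "det (c P) = 0"
    then have "det (c (mat 1)) = 0"
      by (simp add: c_mult det_mul flip: PP(1))
    moreover have "c (mat 1) = mat 1"
      by (simp add: c_def mat_def vec_eq_iff one_pCons)
    ultimately show False by simp
  qed
  have "(mat [:0, 1:] - c S) ** c P = c P ** (mat [:0, 1:] - c ?D)"
  proof -
    have "mat [:0, 1:] ** A = A ** mat [:0, 1:]" for A :: "real poly ^ 'n ^ 'n"
      by (simp add: matrix_matrix_mult_def mat_def vec_eq_iff mult_delta_left mult_delta_right mult.commute)
    moreover have "(A - B) ** C = A ** C - B ** C" "C ** (A - B) = C ** A - C ** B"
      for A B C :: "real poly ^ 'n ^ 'n"
      by (simp_all add: matrix_matrix_mult_def vec_eq_iff left_diff_distrib right_diff_distrib sum_subtractf)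
    ultimately show ?thesis
      by (simp only: SP flip: c_mult)
  qed
  from arg_cong[OF this, of det]
  have "det (mat [:0, 1:] - c S) * det (c P) = det (c P) * det (mat [:0, 1:] - c ?D)"
    by (simp only: det_mul)
  then have "det (mat [:0, 1:] - c S) = det (mat [:0, 1:] - c ?D)"
    using det_cP by simp
  also have "\<dots> = (\<Prod>i\<in>UNIV. [:- d i, 1:])"
    by (subst det_diagonal) (auto simp: c_def mat_def)
  also have "mat [:0, 1:] - c S = (\<chi> i j. (if i = j then [:0, 1:] else 0) - [:S $ i $ j:])"
    by (simp add: c_def mat_def vec_eq_iff)
  finally have "char_poly S = (\<Prod>i\<in>UNIV. [:- d i, 1:])"
    by (simp add: char_poly_def)
  then have "eigenvalues S = (\<Sum>i\<in>UNIV. {#d i#})"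
    by (simp add: eigenvalues_def proots_prod)
  moreover have "prod_mset (\<Sum>i\<in>I. {#d i#}) = (\<Prod>i\<in>I. d i)" if "finite I" for I
    using that by (induction I) auto
  ultimately show "prod_mset (eigenvalues S) = det S"
    by (simp add: det_S)
qed


section \<open>The multivariate normal distribution\<close>

lemma nn_integral_lborel_translate:
  fixes w :: "'b::euclidean_space"
  assumes [measurable]: "h \<in> borel_measurable borel"
  shows "(\<integral>\<^sup>+x. h x \<partial>lborel) = (\<integral>\<^sup>+x. h (w + x) \<partial>lborel)"
proof -
  have "(\<integral>\<^sup>+x. h x \<partial>lborel) = (\<integral>\<^sup>+x. h x \<partial>distr lborel borel ((+) w))"
    by (simp add: lborel_distr_plus)
  also have "\<dots> = (\<integral>\<^sup>+x. h (w + x) \<partial>lborel)"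
    by (subst nn_integral_distr) auto
  finally show ?thesis .
qed

text \<open>By \<open>shift\<close>, f(x) / N(u . x) is constant along \<open>w\<close>, so
  \<open>f\<close> factors into N(u . x) and a transversal part. Integrating out the latter leaves
  \<open>N\<close> as the density of u . x.\<close>

lemma nn_integral_linear_functional:
  fixes f :: "'b::euclidean_space \<Rightarrow> real" and N :: "real \<Rightarrow> real" and u w :: 'b and g :: "real \<Rightarrow> ennreal"
  assumes [measurable]: "f \<in> borel_measurable borel" "N \<in> borel_measurable borel"
    and f: "\<And>x. 0 \<le> f x" and N: "\<And>s. 0 < N s"
    and f1: "(\<integral>\<^sup>+x. f x \<partial>lborel) = 1" and N1: "(\<integral>\<^sup>+s. N s \<partial>lborel) = 1"
    and uw: "u \<bullet> w = 1"
    and shift: "\<And>x t. f (t *\<^sub>R w + x) * N (u \<bullet> x) = f x * N (u \<bullet> x + t)"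
    and g: "g \<in> borel_measurable borel"
  shows "(\<integral>\<^sup>+x. f x * g (u \<bullet> x) \<partial>lborel) = (\<integral>\<^sup>+s. N s * g s \<partial>lborel)"
proof -
  \<comment> \<open>The integral of the transversal part over a slab of width 1 along
    \<open>w\<close>. It is the same for every \<open>g\<close>, so taking \<open>g\<close> constant
    evaluates it.\<close>
  define \<kappa> where "\<kappa> = (\<integral>\<^sup>+x. indicator {0..1} (u \<bullet> x) * ennreal (f x / N (u \<bullet> x)) \<partial>lborel)"
  have main: "(\<integral>\<^sup>+x. f x * g (u \<bullet> x) \<partial>lborel) = \<kappa> * (\<integral>\<^sup>+s. N s * g s \<partial>lborel)"
    if [measurable]: "g \<in> borel_measurable borel" for g :: "real \<Rightarrow> ennreal"
  proof -
    \<comment> \<open>Insert \<open>1 = \<integral> indicator {0..1} (u \<bullet> x - t) dt\<close>, exchange the integrals and translate by \<open>t *\<^sub>R w\<close>.\<close>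
    have "(\<integral>\<^sup>+x. f x * g (u \<bullet> x) \<partial>lborel) =
        (\<integral>\<^sup>+x. (\<integral>\<^sup>+t. f x * g (u \<bullet> x) * indicator {0..1} (u \<bullet> x - t) \<partial>lborel) \<partial>lborel)"
    proof (rule nn_integral_cong)
      fix x :: 'b
      have "(\<integral>\<^sup>+t. indicator {0..1} (u \<bullet> x - t) \<partial>lborel) = (\<integral>\<^sup>+t. indicator {u \<bullet> x - 1..u \<bullet> x} t \<partial>lborel)"
        by (intro nn_integral_cong) (auto simp: indicator_def)
      then show "f x * g (u \<bullet> x) = (\<integral>\<^sup>+t. f x * g (u \<bullet> x) * indicator {0..1} (u \<bullet> x - t) \<partial>lborel)"
        by (simp add: nn_integral_cmult)
    qed
    also have "\<dots> = (\<integral>\<^sup>+t. (\<integral>\<^sup>+x. f x * g (u \<bullet> x) * indicator {0..1} (u \<bullet> x - t) \<partial>lborel) \<partial>lborel)"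
      by (rule lborel_pair.Fubini') measurable
    also have "\<dots> = (\<integral>\<^sup>+t. (\<integral>\<^sup>+x. f (t *\<^sub>R w + x) * g (u \<bullet> x + t) * indicator {0..1} (u \<bullet> x) \<partial>lborel) \<partial>lborel)"
    proof (rule nn_integral_cong)
      fix t :: real
      show "(\<integral>\<^sup>+x. f x * g (u \<bullet> x) * indicator {0..1} (u \<bullet> x - t) \<partial>lborel) =
        (\<integral>\<^sup>+x. f (t *\<^sub>R w + x) * g (u \<bullet> x + t) * indicator {0..1} (u \<bullet> x) \<partial>lborel)"
        by (subst nn_integral_lborel_translate[where w = "t *\<^sub>R w"])
          (auto simp: inner_add_right uw add.commute)
    qed
    also have "\<dots> = (\<integral>\<^sup>+x. (\<integral>\<^sup>+t. f (t *\<^sub>R w + x) * g (u \<bullet> x + t) * indicator {0..1} (u \<bullet> x) \<partial>lborel) \<partial>lborel)"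
      by (rule lborel_pair.Fubini'[symmetric]) measurable
    also have "\<dots> = (\<integral>\<^sup>+x. indicator {0..1} (u \<bullet> x) * ennreal (f x / N (u \<bullet> x)) * (\<integral>\<^sup>+s. N s * g s \<partial>lborel) \<partial>lborel)"
    proof (rule nn_integral_cong)
      fix x :: 'b
      have "ennreal (f (t *\<^sub>R w + x)) = ennreal (f x / N (u \<bullet> x)) * ennreal (N (u \<bullet> x + t))" for t
      proof -
        have "f (t *\<^sub>R w + x) = f x / N (u \<bullet> x) * N (u \<bullet> x + t)"
          using shift[where x = x and t = t] N[of "u \<bullet> x"] by (simp add: field_simps)
        then show ?thesis
          using f N by (simp add: less_imp_le flip: ennreal_mult)
      qed
      then have "(\<integral>\<^sup>+t. f (t *\<^sub>R w + x) * g (u \<bullet> x + t) * indicator {0..1} (u \<bullet> x) \<partial>lborel) =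
        (\<integral>\<^sup>+t. indicator {0..1} (u \<bullet> x) * ennreal (f x / N (u \<bullet> x)) * (N (u \<bullet> x + t) * g (u \<bullet> x + t)) \<partial>lborel)"
        by (intro nn_integral_cong) (simp add: mult_ac)
      also have "\<dots> = indicator {0..1} (u \<bullet> x) * ennreal (f x / N (u \<bullet> x)) * (\<integral>\<^sup>+t. N (u \<bullet> x + t) * g (u \<bullet> x + t) \<partial>lborel)"
        by (intro nn_integral_cmult) measurable
      also have "(\<integral>\<^sup>+t. N (u \<bullet> x + t) * g (u \<bullet> x + t) \<partial>lborel) = (\<integral>\<^sup>+s. N s * g s \<partial>lborel)"
        by (subst nn_integral_lborel_translate[where w = "u \<bullet> x" and h = "\<lambda>s. N s * g s"]) auto
      finally show "(\<integral>\<^sup>+t. f (t *\<^sub>R w + x) * g (u \<bullet> x + t) * indicator {0..1} (u \<bullet> x) \<partial>lborel) =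
        indicator {0..1} (u \<bullet> x) * ennreal (f x / N (u \<bullet> x)) * (\<integral>\<^sup>+s. N s * g s \<partial>lborel)" .
    qed
    also have "\<dots> = \<kappa> * (\<integral>\<^sup>+s. N s * g s \<partial>lborel)"
      unfolding \<kappa>_def by (intro nn_integral_multc) measurable
    finally show ?thesis .
  qed
  have "\<kappa> = 1"
    using main[of "\<lambda>_. 1"] f1 N1 by simp
  with main[OF g] show ?thesis by simp
qed

text \<open>The first integral settles the scalar normal law. Subtracting the entropy integral gives
  the second, which the coordinates of a normal vector require. The constants come from Gamma(1/2) =
  sqrt(pi) and Digamma(1/2) = -gamma - 2 ln 2.\<close>

lemma has_bochner_integral_normal_ln_abs:
  assumes \<sigma>: "0 < \<sigma>"
  shows "has_bochner_integral lborel (\<lambda>x. normal_density 0 \<sigma> x * ln (\<bar>x\<bar> * normal_density 0 \<sigma> x))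
      (- (ln pi + euler_mascheroni + 1) / 2 - ln 2)" (is ?A)
    and "has_bochner_integral lborel (\<lambda>x. normal_density 0 \<sigma> x * ln \<bar>x\<bar>)
      (ln \<sigma> - (euler_mascheroni + ln 2) / 2)" (is ?B)
proof -
  have one: "has_bochner_integral lborel (normal_density 0 \<sigma>) 1"
    using \<sigma> by (simp add: has_bochner_integral_iff)
  have "has_bochner_integral lborel (\<lambda>x. normal_density 0 \<sigma> x * ln (\<bar>x\<bar> * normal_density 0 \<sigma> x))
      (ln 2 - ln (Gamma (1 / 2)) - ln 2 + 1 / 2 * Digamma (1 / 2) - 1 / 2)"
    using \<sigma>
    by (intro has_bochner_integral_symmetric_generalized_gamma[OF one, where a = 1 and k = 2
          and c = "1 / (2 * \<sigma>\<^sup>2)" and K = "1 / sqrt (2 * pi * \<sigma>\<^sup>2)"])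
      (auto simp: normal_density_def)
  moreover have "ln 2 - ln (Gamma (1 / 2)) - ln 2 + 1 / 2 * Digamma (1 / 2) - 1 / 2 =
      - (ln pi + euler_mascheroni + 1) / 2 - (ln 2 :: real)"
    by (simp add: Gamma_one_half_real Digamma_one_half ln_sqrt field_simps)
  ultimately show A: ?A
    by (simp only:)
  have pos: "0 < normal_density 0 \<sigma> x" for x
    using \<sigma> by (rule normal_density_pos)
  have "AE x in lborel. normal_density 0 \<sigma> x * ln (\<bar>x\<bar> * normal_density 0 \<sigma> x)
      - normal_density 0 \<sigma> x * ln (normal_density 0 \<sigma> x) = normal_density 0 \<sigma> x * ln \<bar>x\<bar>"
    using AE_lborel_singleton[of "0::real"]
    by (rule eventually_mono) (simp add: ln_mult pos algebra_simps less_imp_neq[OF pos, symmetric])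
  moreover have "has_bochner_integral lborel
      (\<lambda>x. normal_density 0 \<sigma> x * ln (\<bar>x\<bar> * normal_density 0 \<sigma> x) - normal_density 0 \<sigma> x * ln (normal_density 0 \<sigma> x))
      ((- (ln pi + euler_mascheroni + 1) / 2 - ln 2) - (- ln (\<sigma> * sqrt (2 * pi * exp 1))))"
    by (intro has_bochner_integral_diff A has_bochner_integral_normal_entropy \<sigma>)
  ultimately have "has_bochner_integral lborel (\<lambda>x. normal_density 0 \<sigma> x * ln \<bar>x\<bar>)
      ((- (ln pi + euler_mascheroni + 1) / 2 - ln 2) - (- ln (\<sigma> * sqrt (2 * pi * exp 1))))"
    by (subst has_bochner_integral_cong_AE[symmetric]) auto
  moreover have "(- (ln pi + euler_mascheroni + 1) / 2 - ln 2) - (- ln (\<sigma> * sqrt (2 * pi * exp 1))) =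
      ln \<sigma> - (euler_mascheroni + ln 2) / 2"
    using \<sigma> by (simp add: ln_mult ln_sqrt field_simps)
  ultimately show ?B
    by (simp only:)
qed

text \<open>Since \<open>q\<close> is homogeneous of degree 2, raising the density to the power 1 +
  t amounts, up to a constant, to dilating by sqrt(1 + t). The Jacobian of the dilation produces the
  term with \<open>DIM('b)\<close>.\<close>

lemma has_bochner_integral_gaussian_entropy:
  fixes q :: "'b::euclidean_space \<Rightarrow> real"
  assumes [measurable]: "q \<in> borel_measurable borel" and q: "\<And>a x. q (a *\<^sub>R x) = a\<^sup>2 * q x"
    and C: "0 < C" and one: "has_bochner_integral lborel (\<lambda>x. exp (- q x / 2) / C) 1"
  shows "has_bochner_integral lborel (\<lambda>x. exp (- q x / 2) / C * ln (exp (- q x / 2) / C)) (- ln C - DIM('b) / 2)"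
proof (rule has_bochner_integral_ln_moment[OF _ _ _ _ zero_less_one])
  fix t :: real assume t: "\<bar>t\<bar> < 1"
  let ?f = "\<lambda>x. exp (- q x / 2) / C"
  define c where "c = sqrt (1 + t)"
  have c: "0 < c" "c\<^sup>2 = 1 + t"
    using t by (auto simp: c_def)
  have "(\<integral>\<^sup>+x. ?f x \<partial>lborel) = 1"
    using one C by (subst nn_integral_eq_integral) (auto simp: has_bochner_integral_iff)
  moreover have "(\<integral>\<^sup>+x. ?f x \<partial>lborel) = ennreal (c ^ DIM('b)) * (\<integral>\<^sup>+x. ?f (c *\<^sub>R x) \<partial>lborel)"
    using c by (subst lborel_affine[of c 0])
      (auto simp: nn_integral_density nn_integral_distr nn_integral_cmult)
  ultimately have "ennreal (c ^ DIM('b)) * (\<integral>\<^sup>+x. ?f (c *\<^sub>R x) \<partial>lborel) = 1"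
    by simp
  \<comment> \<open>The multiplier cancels the Jacobian and supplies the constant that turns the
    dilated density into \<open>?f x * ?f x powr t\<close>.\<close>
  then have "ennreal (C powr - t / c ^ DIM('b)) * (ennreal (c ^ DIM('b)) * (\<integral>\<^sup>+x. ?f (c *\<^sub>R x) \<partial>lborel))
      = ennreal (C powr - t / c ^ DIM('b))"
    by simp
  also have "ennreal (C powr - t / c ^ DIM('b)) * (ennreal (c ^ DIM('b)) * (\<integral>\<^sup>+x. ?f (c *\<^sub>R x) \<partial>lborel)) =
      (\<integral>\<^sup>+x. ennreal (C powr - t) * ?f (c *\<^sub>R x) \<partial>lborel)"
    using c by (subst nn_integral_cmult) (auto simp: mult.assoc[symmetric] ennreal_mult[symmetric])
  also have "\<dots> = (\<integral>\<^sup>+x. ?f x * ?f x powr t \<partial>lborel)"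
  proof (intro nn_integral_cong)
    fix x
    have "C powr - t * ?f (c *\<^sub>R x) = ?f x * ?f x powr t"
      using C by (simp add: q c powr_divide powr_minus powr_def[of "exp _"] field_simps flip: exp_add)
    then show "ennreal (C powr - t) * ?f (c *\<^sub>R x) = ennreal (?f x * ?f x powr t)"
      using C by (simp flip: ennreal_mult)
  qed
  finally have "has_bochner_integral lborel (\<lambda>x. ?f x * ?f x powr t) (C powr - t / c ^ DIM('b))"
    using C c by (intro has_bochner_integral_nn_integral) auto
  moreover have "C powr - t / c ^ DIM('b) = C powr - t * (1 + t) powr (- (real DIM('b) / 2))"
  proof -
    have "c = (1 + t) powr (1 / 2)"
      using t by (simp add: c_def powr_half_sqrt)
    then have "c powr real DIM('b) = (1 + t) powr (real DIM('b) / 2)"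
      by (simp add: powr_powr)
    then have "c ^ DIM('b) = (1 + t) powr (real DIM('b) / 2)"
      by (simp only: powr_realpow[OF c(1)])
    then show ?thesis
      by (simp only: powr_minus divide_inverse)
  qed
  ultimately show "has_bochner_integral lborel (\<lambda>x. ?f x * ?f x powr t)
      (C powr - t * (1 + t) powr (- (real DIM('b) / 2)))"
    by (simp only:)
next
  show "((\<lambda>t. C powr - t * (1 + t) powr (- (real DIM('b) / 2))) has_real_derivative - ln C - DIM('b) / 2) (at 0)"
    using C by (auto intro!: derivative_eq_intros)
qed (use C in auto)

lemma fp_entropy_vec_mv_normal:
  fixes S :: "real ^ 'n ^ 'n" and Y :: "'a \<Rightarrow> real ^ 'n"
  assumes M: "prob_space M" and S: "pos_def_matrix S"
    and Y: "distributed M lborel Y (\<lambda>x. ennreal (mv_normal_density S x))"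
  shows "fp_entropy_vec_exists M Y \<and>
    fp_entropy_vec p M Y =
      CARD('n) * (p + 1/2 * log 2 (2 * pi * exp 1) + euler_mascheroni / (2 * ln 2))
        + 1/2 * log 2 (prod_mset (eigenvalues S) / (\<Prod>i\<in>UNIV. S $ i $ i))"
proof -
  interpret prob_space M by fact
  interpret information_space M 2 by standard simp
  let ?n = "real CARD('n)"
  let ?f = "mv_normal_density S"
  define q where "q x = x \<bullet> (matrix_inv S *v x)" for x
  define C where "C = sqrt ((2 * pi) ^ CARD('n) * det S)"
  note det = pos_def_matrix_eigenvalues[OF S]
  have C: "0 < C"
    using det(2) by (simp add: C_def)
  have ln_C: "ln C = (?n * ln (2 * pi) + ln (det S)) / 2"
    using det(2) by (simp add: C_def ln_sqrt ln_mult ln_realpow algebra_simps)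
  have f_eq: "?f x = exp (- q x / 2) / C" for x
    by (simp add: mv_normal_density_def q_def C_def)
  have nn: "0 \<le> ?f x" for x
    using C by (simp add: f_eq)
  have [measurable]: "q \<in> borel_measurable borel"
    unfolding q_def by (intro borel_measurable_continuous_onI continuous_intros)
  have f_eq': "?f = (\<lambda>x. exp (- q x / 2) / C)"
    using f_eq by blast
  have [measurable]: "?f \<in> borel_measurable borel"
    unfolding f_eq' by measurable
  have [measurable]: "Y \<in> borel_measurable M"
    using Y by (simp add: distributed_def)
  have one: "has_bochner_integral lborel ?f 1"
    by (rule distributed_integral_eq_1[OF M Y nn])
  then have one_nn: "(\<integral>\<^sup>+x. ?f x \<partial>lborel) = 1"
    using nn by (subst nn_integral_eq_integral) (auto simp: has_bochner_integral_iff)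

  have ent: "has_bochner_integral lborel (\<lambda>x. ?f x * ln (?f x)) (- ln C - ?n / 2)"
  proof -
    have "q (a *\<^sub>R x) = a\<^sup>2 * q x" for a x
      by (simp add: q_def matrix_vector_mult_scaleR power2_eq_square)
    from has_bochner_integral_gaussian_entropy[OF _ this C] one show ?thesis
      by (simp add: f_eq')
  qed
  then have "has_bochner_integral lborel (\<lambda>x. ?f x * ln (?f x) / ln 2) ((- ln C - ?n / 2) / ln 2)"
    by (rule has_bochner_integral_divide_zero)
  then have ent2: "has_bochner_integral lborel (\<lambda>x. ?f x * log 2 (?f x)) ((- ln C - ?n / 2) / ln 2)"
    by (simp add: log_def)

  have S_pos: "0 < S $ j $ j" for j
  proof -
    have "0 < axis j 1 \<bullet> (S *v axis j 1)"
      using S by (simp add: pos_def_matrix_def axis_eq_0_iff)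
    then show ?thesis
      by (simp add: inner_axis' matrix_vector_mul_component inner_axis)
  qed
  have coord: "has_bochner_integral M (\<lambda>\<omega>. log 2 \<bar>Y \<omega> $ j\<bar>)
      ((ln (S $ j $ j) - (euler_mascheroni + ln 2)) / 2 / ln 2)" for j
  proof -
    define \<sigma> where "\<sigma> = sqrt (S $ j $ j)"
    define u :: "real ^ 'n" where "u = axis j 1"
    \<comment> \<open>The regression direction Cov(Y, Y_j) / Var(Y_j). As
      \<open>matrix_inv S\<close> sends it to a multiple of \<open>u\<close>, moving along it
      changes the quadratic form by an amount that depends on \<open>x\<close> only through
      \<open>u \<bullet> x\<close>.\<close>
    define w where "w = (1 / S $ j $ j) *\<^sub>R (S *v u)"
    have \<sigma>: "0 < \<sigma>" "\<sigma>\<^sup>2 = S $ j $ j"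
      using S_pos[of j] by (auto simp: \<sigma>_def)
    have u_S: "u \<bullet> (S *v u) = \<sigma>\<^sup>2"
      by (simp add: u_def inner_axis' matrix_vector_mul_component inner_axis \<sigma>)
    have u_x: "u \<bullet> x = x $ j" for x
      by (simp add: u_def inner_axis')
    have inv: "S ** matrix_inv S = mat 1" "matrix_inv S ** S = mat 1"
    proof -
      have "\<exists>B. S ** B = mat 1 \<and> B ** S = mat 1"
        using det(2) invertible_det_nz[of S] by (simp add: invertible_def)
      from someI_ex[OF this] show "S ** matrix_inv S = mat 1" "matrix_inv S ** S = mat 1"
        by (simp_all add: matrix_inv_def)
    qed
    have S_adj: "(S *v x) \<bullet> y = x \<bullet> (S *v y)" for x y
      using S by (metis pos_def_matrix_def dot_lmul_matrix transpose_matrix_vector)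
    \<comment> \<open>The cross term and the square of \<open>t\<close> together are the change of
      the exponent of a one-dimensional normal density with variance S_jj.\<close>
    have q_shift: "q (t *\<^sub>R w + x) = q x + ((u \<bullet> x + t)\<^sup>2 - (u \<bullet> x)\<^sup>2) / \<sigma>\<^sup>2" for t x
    proof -
      let ?s = "t / \<sigma>\<^sup>2"
      have "t *\<^sub>R w = ?s *\<^sub>R (S *v u)"
        by (simp add: w_def \<sigma>)
      then have "q (t *\<^sub>R w + x) = (?s *\<^sub>R (S *v u) + x) \<bullet> (?s *\<^sub>R u + matrix_inv S *v x)"
        by (simp add: q_def matrix_vector_right_distrib matrix_vector_mult_scaleR matrix_vector_mul_assoc inv)
      also have "\<dots> = ?s\<^sup>2 * ((S *v u) \<bullet> u) + ?s * ((S *v u) \<bullet> (matrix_inv S *v x)) + ?s * (x \<bullet> u) + q x"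
        by (simp add: q_def inner_add_left inner_add_right power2_eq_square algebra_simps)
      also have "(S *v u) \<bullet> (matrix_inv S *v x) = u \<bullet> x"
        by (simp add: S_adj matrix_vector_mul_assoc inv)
      also have "(S *v u) \<bullet> u = \<sigma>\<^sup>2"
        by (simp add: S_adj u_S)
      finally show ?thesis
        using \<sigma>(1) by (simp add: inner_commute power2_eq_square field_simps)
    qed
    have shift: "?f (t *\<^sub>R w + x) * normal_density 0 \<sigma> (u \<bullet> x) = ?f x * normal_density 0 \<sigma> (u \<bullet> x + t)" for x t
    proof -
      have "- (q x + ((u \<bullet> x + t)\<^sup>2 - (u \<bullet> x)\<^sup>2) / \<sigma>\<^sup>2) / 2 + - (u \<bullet> x)\<^sup>2 / (2 * \<sigma>\<^sup>2) =
        - q x / 2 + - (u \<bullet> x + t)\<^sup>2 / (2 * \<sigma>\<^sup>2)"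
        using \<sigma>(1) by (simp add: field_simps)
      from arg_cong[OF this, of exp]
      have e: "exp (- (q x + ((u \<bullet> x + t)\<^sup>2 - (u \<bullet> x)\<^sup>2) / \<sigma>\<^sup>2) / 2) * exp (- (u \<bullet> x)\<^sup>2 / (2 * \<sigma>\<^sup>2)) =
        exp (- q x / 2) * exp (- (u \<bullet> x + t)\<^sup>2 / (2 * \<sigma>\<^sup>2))"
        by (simp only: exp_add)
      have "E1 / C * (1 / Z * E2) = E3 / C * (1 / Z * E4)" if "E1 * E2 = E3 * E4" for E1 E2 E3 E4 Z :: real
        using that by (simp add: field_simps)
      from this[OF e, of "sqrt (2 * pi * \<sigma>\<^sup>2)"] show ?thesis
        by (simp only: f_eq q_shift normal_density_def diff_0_right)
    qed
    have N1: "(\<integral>\<^sup>+s. normal_density 0 \<sigma> s \<partial>lborel) = 1"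
      using \<sigma> by (subst nn_integral_eq_integral) auto
    have uw: "u \<bullet> w = 1"
      using u_S \<sigma> S_pos[of j] by (simp add: w_def)
    have "(\<lambda>\<omega>. u \<bullet> Y \<omega>) \<in> borel_measurable M"
      by measurable
    then have [measurable]: "(\<lambda>\<omega>. Y \<omega> $ j) \<in> borel_measurable M"
      by (simp add: u_x)
    have "distr M lborel (\<lambda>\<omega>. Y \<omega> $ j) = density lborel (\<lambda>s. ennreal (normal_density 0 \<sigma> s))"
    proof (rule measure_eqI)
      fix A assume "A \<in> sets (distr M lborel (\<lambda>\<omega>. Y \<omega> $ j))"
      then have [measurable]: "A \<in> sets borel" by simp
      have "emeasure (distr M lborel (\<lambda>\<omega>. Y \<omega> $ j)) A = (\<integral>\<^sup>+\<omega>. indicator A (u \<bullet> Y \<omega>) \<partial>M)"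
      proof -
        have "(\<integral>\<^sup>+\<omega>. indicator A (u \<bullet> Y \<omega>) \<partial>M) =
            (\<integral>\<^sup>+\<omega>. indicator ((\<lambda>\<omega>. Y \<omega> $ j) -` A \<inter> space M) \<omega> \<partial>M)"
          by (intro nn_integral_cong) (auto simp: indicator_def u_x)
        then show ?thesis
          by (simp add: emeasure_distr)
      qed
      also have "\<dots> = (\<integral>\<^sup>+x. ennreal (?f x) * indicator A (u \<bullet> x) \<partial>lborel)"
        by (rule distributed_nn_integral[OF Y, symmetric]) measurable
      also have "\<dots> = (\<integral>\<^sup>+s. ennreal (normal_density 0 \<sigma> s) * indicator A s \<partial>lborel)"
        by (rule nn_integral_linear_functional[OF _ _ nn _ one_nn N1 uw shift]) (use \<sigma> normal_density_pos in auto)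
      also have "\<dots> = emeasure (density lborel (\<lambda>s. ennreal (normal_density 0 \<sigma> s))) A"
        by (subst emeasure_density) auto
      finally show "emeasure (distr M lborel (\<lambda>\<omega>. Y \<omega> $ j)) A =
        emeasure (density lborel (\<lambda>s. ennreal (normal_density 0 \<sigma> s))) A" .
    qed simp
    then have D: "distributed M lborel (\<lambda>\<omega>. Y \<omega> $ j) (\<lambda>s. ennreal (normal_density 0 \<sigma> s))"
      by (simp add: distributed_def)
    have "has_bochner_integral M (\<lambda>\<omega>. ln \<bar>Y \<omega> $ j\<bar>) (ln \<sigma> - (euler_mascheroni + ln 2) / 2)"
      by (rule distributed_has_bochner_integral[OF D _ _ has_bochner_integral_normal_ln_abs(2)[OF \<sigma>(1)]]) auto
    from has_bochner_integral_divide_zero[OF this, of "ln 2"] show ?thesis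
      using S_pos[of j] by (simp add: log_def \<sigma>_def ln_sqrt diff_divide_distrib)
  qed

  note pdf = distributed_pdf[OF M Y nn]
  have "integrable lborel (\<lambda>x. pdf M Y x * log 2 (pdf M Y x)) \<longleftrightarrow> integrable lborel (\<lambda>x. ?f x * log 2 (?f x))"
    using pdf(1) by (intro integrable_cong_AE) (auto elim: eventually_mono)
  then have ex: "fp_entropy_vec_exists M Y"
    using pdf(2) ent2 coord by (auto simp: fp_entropy_vec_exists_def has_bochner_integral_iff)

  have "entropy 2 lborel Y = - (\<integral>x. ?f x * log 2 (?f x) \<partial>lborel)"
    by (rule entropy_distr[OF Y nn])
  then have H: "entropy 2 lborel Y = (ln C + ?n / 2) / ln 2"
    using ent2 by (simp add: has_bochner_integral_iff minus_divide_left)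
  have "(\<Sum>j\<in>UNIV. \<integral>\<omega>. log 2 \<bar>Y \<omega> $ j\<bar> \<partial>M) =
      (\<Sum>j\<in>(UNIV :: 'n set). (ln (S $ j $ j) - (euler_mascheroni + ln 2)) / 2 / ln 2)"
    using coord by (intro sum.cong) (auto simp: has_bochner_integral_iff)
  also have "\<dots> = (ln (\<Prod>j\<in>UNIV. S $ j $ j) - ?n * (euler_mascheroni + ln 2)) / 2 / ln 2"
  proof -
    have "ln (\<Prod>j\<in>UNIV. S $ j $ j) = (\<Sum>j\<in>UNIV. ln (S $ j $ j))"
      by (rule ln_prod) (simp_all add: less_imp_neq[OF S_pos, symmetric])
    then show ?thesis
      by (simp only: sum_divide_distrib[symmetric] sum_subtractf sum_constant)
  qed
  finally have L: "(\<Sum>j\<in>UNIV. \<integral>\<omega>. log 2 \<bar>Y \<omega> $ j\<bar> \<partial>M) =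
      (ln (\<Prod>j\<in>UNIV. S $ j $ j) - ?n * (euler_mascheroni + ln 2)) / 2 / ln 2" .
  have P: "0 < (\<Prod>j\<in>UNIV. S $ j $ j)"
    using S_pos by (simp add: prod_pos)
  have "fp_entropy_vec p M Y = ?n * (real p - 1/2) + (ln C + ?n / 2) / ln 2
      - (ln (\<Prod>j\<in>UNIV. S $ j $ j) - ?n * (euler_mascheroni + ln 2)) / 2 / ln 2"
    by (simp only: fp_entropy_vec_def H L)
  also have "\<dots> = ?n * (p + 1/2 * log 2 (2 * pi * exp 1) + euler_mascheroni / (2 * ln 2))
        + 1/2 * log 2 (det S / (\<Prod>i\<in>UNIV. S $ i $ i))"
  proof -
    \<comment> \<open>The letters stand for a = ln(2 pi), b = ln(det S), c = the logarithm of the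
      diagonal product, g = gamma and l = ln 2. The \<open>l\<close> from the means of ln |Y_j|
      cancels the \<open>- 1/2\<close> next to \<open>x\<close>.\<close>
    have *: "n * (x - 1/2) + ((n * a + b) / 2 + n / 2) / l - (c - n * (g + l)) / 2 / l =
      n * (x + 1/2 * ((a + 1) / l) + g / (2 * l)) + 1/2 * ((b - c) / l)" if "l \<noteq> 0" for n x a b c g l :: real
      using that by (simp add: field_simps)
    have log_1: "log 2 (2 * pi * exp 1) = (ln (2 * pi) + 1) / ln 2"
      by (simp add: log_def ln_mult)
    have log_2: "log 2 (det S / (\<Prod>i\<in>UNIV. S $ i $ i)) = (ln (det S) - ln (\<Prod>i\<in>UNIV. S $ i $ i)) / ln 2"
      by (simp only: log_def ln_divide_pos[OF det(2) P])
    show ?thesis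
      unfolding ln_C log_1 log_2 by (rule *) simp
  qed
  finally show ?thesis
    using ex unfolding det(1) by blast
qed


section \<open>The closed forms\<close>

lemma fp_entropy_normal:
  assumes M: "prob_space M" and X: "distributed M lborel X (\<lambda>x. ennreal (normal_density 0 \<sigma> x))"
    and \<sigma>: "0 < \<sigma>"
  shows "fp_entropy_exists M X \<and>
    fp_entropy p M X = p + 1/2 * log 2 (2 * pi * exp 1) + euler_mascheroni / (2 * ln 2)"
  by (rule fp_entropyI[OF M X _ _ has_bochner_integral_normal_ln_abs(1)[OF \<sigma>]])
    (auto simp: log_def ln_mult field_simps)

lemma fp_entropy_gamma:
  assumes M: "prob_space M" and X: "distributed M lborel X (\<lambda>x. ennreal (gamma_density \<alpha> \<theta> x))"
    and pos: "0 < \<alpha>" "0 < \<theta>"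
  shows "fp_entropy_exists M X \<and>
    fp_entropy p M X = p - 1/2 + \<alpha> * log 2 (exp 1) * (1 - Digamma \<alpha>) + log 2 (Gamma \<alpha>)"
  by (rule fp_entropy_generalized_gamma[OF M X, where a = \<alpha> and c = "1 / \<theta>" and k = 1 and r = \<alpha>
        and K = "1 / (Gamma \<alpha> * \<theta> powr \<alpha>)"])
    (use pos in \<open>auto simp: gamma_density_def[abs_def] log_def field_simps\<close>)

lemma fp_entropy_chi_square:
  assumes M: "prob_space M" and X: "distributed M lborel X (\<lambda>x. ennreal (chi_square_density k x))"
    and pos: "0 < k"
  shows "fp_entropy_exists M X \<and>
    fp_entropy p M X = p - 1/2 + k / 2 * log 2 (exp 1) * (1 - Digamma (k / 2)) + log 2 (Gamma (k / 2))"
proof -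
  have "chi_square_density k = gamma_density (k / 2) 2"
    by (auto simp: chi_square_density_def gamma_density_def)
  then show ?thesis
    using fp_entropy_gamma[OF M, of X "k / 2" 2] X pos by simp
qed

lemma fp_entropy_laplace:
  assumes M: "prob_space M" and X: "distributed M lborel X (\<lambda>x. ennreal (laplace_density b x))"
    and b: "0 < b"
  shows "fp_entropy_exists M X \<and> fp_entropy p M X = p + 1/2 + (1 + euler_mascheroni) / ln 2"
proof -
  have nn: "0 \<le> laplace_density b x" for x
    using b by (simp add: laplace_density_def)
  have [measurable]: "laplace_density b \<in> borel_measurable borel"
    unfolding laplace_density_def[abs_def] by measurable
  have "has_bochner_integral lborel (\<lambda>x. laplace_density b x * ln (\<bar>x\<bar> * laplace_density b x))
      (ln 1 - ln (Gamma 1) - ln 2 + 1 * Digamma 1 - 1)"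
    using b
    by (intro has_bochner_integral_symmetric_generalized_gamma[OF distributed_integral_eq_1[OF M X nn],
          where a = 1 and c = "1 / b" and k = 1 and K = "1 / (2 * b)"])
      (auto simp: laplace_density_def)
  then show ?thesis
    by (rule fp_entropyI[OF M X nn, rotated]) (auto simp: field_simps)
qed

text \<open>Here \<open>a = k\<close>, hence \<open>r = 1\<close>, and only Gamma(1) = 1 and
  Digamma(1) = -gamma remain. Splitting the powers of \<open>x / l\<close> exposes \<open>K\<close>
  and \<open>c\<close>.\<close>

lemma fp_entropy_weibull:
  assumes M: "prob_space M" and X: "distributed M lborel X (\<lambda>x. ennreal (weibull_density l k x))"
    and pos: "0 < l" "0 < k"
  shows "fp_entropy_exists M X \<and> fp_entropy p M X = p - 1/2 + (1 + euler_mascheroni) / ln 2 - log 2 k"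
proof (rule fp_entropy_generalized_gamma[OF M X, where a = k and c = "(1 / l) powr k" and k = k and r = 1
      and K = "k / l * (1 / l) powr (k - 1)"])
  show "weibull_density l k x = k / l * (1 / l) powr (k - 1) * x powr (k - 1) * exp (- ((1 / l) powr k) * x powr k)"
    if "0 < x" for x
  proof -
    have "(x / l) powr e = (1 / l) powr e * x powr e" for e
      using powr_mult[of "1 / l" x e] by simp
    then show ?thesis
      using that by (simp add: weibull_density_def)
  qed
  show "weibull_density l k \<in> borel_measurable borel"
    unfolding weibull_density_def[abs_def] by measurable
qed (use pos in \<open>auto simp: weibull_density_def log_def field_simps\<close>)

theorem mainTheorem5:
  fixes M :: "'a measure" and X :: "'a \<Rightarrow> real" and Y :: "'a \<Rightarrow> real ^ 'n" and p :: nat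
  assumes "prob_space M" and "p \<ge> 1"
  shows
    "(\<forall>\<sigma>>0. distributed M lborel X (\<lambda>x. ennreal (normal_density 0 \<sigma> x)) \<longrightarrow>
        fp_entropy_exists M X \<and>
        fp_entropy p M X = p + 1/2 * log 2 (2 * pi * exp 1) + euler_mascheroni / (2 * ln 2)) \<and>
     (\<forall>a>0. distributed M lborel X (\<lambda>x. ennreal (uniform_density (- a) a x)) \<longrightarrow>
        fp_entropy_exists M X \<and>
        fp_entropy p M X = p + 1/2 + log 2 (exp 1)) \<and>
     (\<forall>\<alpha>>0. \<forall>\<theta>>0. distributed M lborel X (\<lambda>x. ennreal (gamma_density \<alpha> \<theta> x)) \<longrightarrow>
        fp_entropy_exists M X \<and>
        fp_entropy p M X =
          p - 1/2 + \<alpha> * log 2 (exp 1) * (1 - Digamma \<alpha>) + log 2 (Gamma \<alpha>)) \<and>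
     (\<forall>k>0. distributed M lborel X (\<lambda>x. ennreal (chi_square_density k x)) \<longrightarrow>
        fp_entropy_exists M X \<and>
        fp_entropy p M X =
          p - 1/2 + k / 2 * log 2 (exp 1) * (1 - Digamma (k / 2)) + log 2 (Gamma (k / 2))) \<and>
     (\<forall>b>0. distributed M lborel X (\<lambda>x. ennreal (laplace_density b x)) \<longrightarrow>
        fp_entropy_exists M X \<and>
        fp_entropy p M X = p + 1/2 + (1 + euler_mascheroni) / ln 2) \<and>
     (\<forall>s>0. distributed M lborel X (\<lambda>x. ennreal (logistic_density s x)) \<longrightarrow>
        fp_entropy_exists M X \<and>
        fp_entropy p M X = p - 1/2 + (2 + euler_mascheroni - ln (pi / 2)) / ln 2) \<and>
     (\<forall>l>0. \<forall>k>0. distributed M lborel X (\<lambda>x. ennreal (weibull_density l k x)) \<longrightarrow>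
        fp_entropy_exists M X \<and>
        fp_entropy p M X = p - 1/2 + (1 + euler_mascheroni) / ln 2 - log 2 k) \<and>
     (\<forall>\<mu>. \<forall>\<sigma>>0. lognormal_distributed M X \<mu> \<sigma> \<longrightarrow>
        fp_entropy_exists M X \<and>
        fp_entropy p M X = p - 1/2 + log 2 (\<sigma> * sqrt (2 * pi * exp 1))) \<and>
     (\<forall>x\<^sub>m>0. \<forall>\<alpha>>0. distributed M lborel X (\<lambda>x. ennreal (pareto_density x\<^sub>m \<alpha> x)) \<longrightarrow>
        fp_entropy_exists M X \<and>
        fp_entropy p M X = p - 1/2 + log 2 (exp 1 / \<alpha>)) \<and>
     (\<forall>\<alpha>>0. \<forall>\<beta>>0. distributed M lborel X (\<lambda>x. ennreal (beta_density \<alpha> \<beta> x)) \<longrightarrow>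
        fp_entropy_exists M X \<and>
        fp_entropy p M X =
          p - 1/2 + log 2 (Beta \<alpha> \<beta>)
            + ((\<alpha> + \<beta> - 1) * Digamma (\<alpha> + \<beta>) - \<alpha> * Digamma \<alpha> - (\<beta> - 1) * Digamma \<beta>) / ln 2) \<and>
     (\<forall>\<nu>>0. \<forall>s>0. student_t_distributed M X \<nu> s \<longrightarrow>
        fp_entropy_exists M X \<and>
        fp_entropy p M X =
          p - 1/2 + log 2 (Beta (\<nu> / 2) (1 / 2))
            + ((\<nu> + 1) / 2 * Digamma ((\<nu> + 1) / 2) - \<nu> / 2 * Digamma (\<nu> / 2)
                - 1 / 2 * Digamma (1 / 2)) / ln 2) \<and>
     (\<forall>S :: real ^ 'n ^ 'n.
        pos_def_matrix S \<and> distributed M lborel Y (\<lambda>x. ennreal (mv_normal_density S x)) \<longrightarrow>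
        fp_entropy_vec_exists M Y \<and>
        fp_entropy_vec p M Y =
          CARD('n) * (p + 1/2 * log 2 (2 * pi * exp 1) + euler_mascheroni / (2 * ln 2))
            + 1/2 * log 2 (prod_mset (eigenvalues S) / (\<Prod>i\<in>UNIV. S $ i $ i)))"
  by (intro conjI[where P = "All P" for P] allI impI; (elim conjE)?;
      rule fp_entropy_normal[OF assms(1)] fp_entropy_uniform[OF assms(1)] fp_entropy_gamma[OF assms(1)]
        fp_entropy_chi_square[OF assms(1)] fp_entropy_laplace[OF assms(1)] fp_entropy_logistic[OF assms(1)]
        fp_entropy_weibull[OF assms(1)] fp_entropy_lognormal[OF assms(1)] fp_entropy_pareto[OF assms(1)]
        fp_entropy_beta[OF assms(1)] fp_entropy_student_t[OF assms(1)] fp_entropy_vec_mv_normal[OF assms(1)];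
      assumption)

end
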